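(* For $j=1,\ldots,N$ and all $s\in\mathbb{C}$ with $\mathrm{Re}(s)\ge0$, $s\notin\{\lambda_1,\ldots,\lambda_N\}$, $$Z_j(s)=\sum_{i=1}^Np_{i,j}\sum_{m=1}^Mq_m\Big(\frac{\lambda_j}{\lambda_j-s}\Big)^mZ_i(as)\beta_i^*(s)+\sum_{i=1}^Np_{i,j}\sum_{m=1}^Mq_m\sum_{l=0}^{m-1}\sum_{k=0}^{l}\frac{(-\lambda_j)^l}{l!}\binom lk\,[Z_i(a\lambda_j)]^{(k)}\,[\beta_i^*(\lambda_j)]^{(l-k)}\Big(1-\Big(\frac{\lambda_j}{\lambda_j-s}\Big)^{m-l}\Big).$$ Equivalently, $\tilde Z(s)=(Z_1(s),\ldots,Z_N(s))^T$ satisfies $$\tilde Z(s)=\widehat H(s)\tilde Z(as)+\widehat V(s),$$ where $\widehat H(s)=\widehat L(s)P^TB^*(s)$, $\widehat L(s)=\mathrm{diag}\Big(\sum_{m=1}^Mq_m\big(\tfrac{\lambda_1}{\lambda_1-s}\big)^m,\ldots,\sum_{m=1}^Mq_m\big(\tfrac{\lambda_N}{\lambda_N-s}\big)^m\Big)$, and $\widehat V(s)=(v_1(s),\ldots,v_N(s))^T$ with $$v_j(s)=\sum_{m=1}^Mq_m\,\widehat e_m\,A_j^{(m)}(s)\,\bar v_j^{(m)} .$$ Here $\widehat e_m$ is the $1\times m$ row vector of ones, $A_j^{(m)}(s)$ is the $m\times m$ diagonal matrix with $(t,t)$ entry $1-\big(\frac{\lambda_j}{\lambda_j-s}\big)^{m-t+1}$,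 $t=1,\ldots,m$, and $\bar v_j^{(m)}=(v_j^{(m)}(0),\ldots,v_j^{(m)}(m-1))^T$ with, for $l=0,\ldots,m-1$, $$v_j^{(m)}(l)=\sum_{k=0}^l\frac{(-\lambda_j)^l}{l!}\binom lk\sum_{i=1}^Np_{i,j}\,[Z_i(a\lambda_j)]^{(k)}\,[\beta_i^*(\lambda_j)]^{(l-k)} .$$
   Context: Let $E=\{1,\ldots,N\}$, $a\in(0,1)$. $(Y_n)_{n\ge0}$ is an irreducible discrete-time Markov chain on $E$ with transition matrix $P=(p_{i,j})$ and stationary distribution $\tilde\pi=(\pi_1,\ldots,\pi_N)^T$. The nonnegative process $W_n$ (workload just before the $n$th arrival) satisfies $W_{n+1}=[aW_n+S_n-A_{n+1}]^+$, where $[x]^+=\max(0,x)$ and $S_n,A_{n+1}\ge0$. Given $Y_n$, the triple $(A_{n+1},S_n,Y_{n+1})$ is independent of the past (in particular of $W_n$), and for $x,y\ge0$ $$P(A_{n+1}\le x,S_n\le y,Y_{n+1}=j\mid Y_n=i)=p_{i,j}F_{S,i}(y)G_{A,j}(x),$$ where $F_{S,i}$ is a distribution function on $[0,\infty)$ and $G_{A,j}$ is the mixed-Erlang distribution function $$G_{A,j}(x)=\sum_{m=1}^Mq_m\Big(1-e^{-\lambda_jx}\sum_{l=0}^{m-1}\frac{(\lambda_jx)^l}{l!}\Big),\quad x\ge0,$$ with $\lambda_j>0$, $q_m\ge0$, $\sum_{m=1}^Mq_m=1$. Notation: $\beta_i^*(s)=\int_0^\infty e^{-st}dF_{S,i}(t)$,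 $B^*(s)=\mathrm{diag}(\beta_1^*(s),\ldots,\beta_N^*(s))$. For $\mathrm{Re}(s)\ge0$, $Z_i(s)=\lim_{n\to\infty}E(e^{-sW_n}1_{\{Y_n=i\}})$; it is assumed that these limits exist and are the transforms $E(e^{-sW}1_{\{Y=i\}})$ of a steady-state pair $(W,Y)$ with $W$ finite and $P(Y=i)=\pi_i$. Derivatives: $[Z_i(a\lambda_j)]^{(k)}$ denotes the $k$th derivative of the function $s\mapsto Z_i(as)$ evaluated at $s=\lambda_j$, and $[\beta_i^*(\lambda_j)]^{(k)}$ the $k$th derivative of $\beta_i^*$ at $\lambda_j$; the zeroth derivative is the function itself. *)

theory Defs
  imports "HOL-Probability.Probability" "Jordan_Normal_Form.Matrix"
begin

definition distribution_function_nonneg :: "(real \<Rightarrow> real) \<Rightarrow> bool" where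
  "distribution_function_nonneg F \<longleftrightarrow>
     mono F \<and> (\<forall>x. continuous (at_right x) F) \<and> (\<forall>x<0. F x = 0) \<and> (F \<longlongrightarrow> 1) at_top"

(* The integral is over the closed half-line, so a possible atom of F at 0 is included. *)
definition laplace_stieltjes :: "(real \<Rightarrow> real) \<Rightarrow> complex \<Rightarrow> complex" where
  "laplace_stieltjes F s = (LINT t:{0..}|interval_measure F. exp (- s * complex_of_real t))"

definition mixed_erlang :: "nat \<Rightarrow> (nat \<Rightarrow> real) \<Rightarrow> real \<Rightarrow> real \<Rightarrow> real" where
  "mixed_erlang M q r x =
     (\<Sum>m=1..M. q m * (1 - exp (- r * x) * (\<Sum>l=0..m-1. (r * x) ^ l / fact l)))"

(* Vectors and matrices of the matrix library are indexed from 0, whereas states are numbered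
   1, ..., N: state i sits at position i - 1. *)
definition transition_mat :: "nat \<Rightarrow> (nat \<Rightarrow> nat \<Rightarrow> real) \<Rightarrow> real mat" where
  "transition_mat N p = mat N N (\<lambda>(i, j). p (Suc i) (Suc j))"

definition stochastic_on :: "nat \<Rightarrow> (nat \<Rightarrow> nat \<Rightarrow> real) \<Rightarrow> bool" where
  "stochastic_on N p \<longleftrightarrow>
     (\<forall>i\<in>{1..N}. (\<forall>j\<in>{1..N}. 0 \<le> p i j) \<and> (\<Sum>j=1..N. p i j) = 1)"

definition irreducible_on :: "nat \<Rightarrow> (nat \<Rightarrow> nat \<Rightarrow> real) \<Rightarrow> bool" where
  "irreducible_on N p \<longleftrightarrow>
     (\<forall>i\<in>{1..N}. \<forall>j\<in>{1..N}. \<exists>n. (transition_mat N p ^\<^sub>m n) $$ (i - 1, j - 1) > 0)"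

definition stationary_distribution :: "nat \<Rightarrow> (nat \<Rightarrow> nat \<Rightarrow> real) \<Rightarrow> (nat \<Rightarrow> real) \<Rightarrow> bool" where
  "stationary_distribution N p \<pi> \<longleftrightarrow>
     (\<forall>i\<in>{1..N}. 0 \<le> \<pi> i) \<and> (\<Sum>i=1..N. \<pi> i) = 1 \<and>
     (\<forall>j\<in>{1..N}. (\<Sum>i=1..N. \<pi> i * p i j) = \<pi> j)"

(* The sigma-algebra of everything that happened before the triple (A (n+1), S n, Y (n+1)). *)
definition past ::
  "'w measure \<Rightarrow> (nat \<Rightarrow> 'w \<Rightarrow> nat) \<Rightarrow> (nat \<Rightarrow> 'w \<Rightarrow> real) \<Rightarrow> (nat \<Rightarrow> 'w \<Rightarrow> real) \<Rightarrow>
   (nat \<Rightarrow> 'w \<Rightarrow> real) \<Rightarrow> nat \<Rightarrow> 'w measure" where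
  "past \<Omega> Y W S A n = sigma (space \<Omega>)
     ({Y k -` B \<inter> space \<Omega> | k B. k \<le> n} \<union>
      {W k -` B \<inter> space \<Omega> | k B. k \<le> n \<and> B \<in> sets borel} \<union>
      {S k -` B \<inter> space \<Omega> | k B. k < n \<and> B \<in> sets borel} \<union>
      {A k -` B \<inter> space \<Omega> | k B. 1 \<le> k \<and> k \<le> n \<and> B \<in> sets borel})"

definition joint_transform ::
  "'w measure \<Rightarrow> ('w \<Rightarrow> real) \<Rightarrow> ('w \<Rightarrow> nat) \<Rightarrow> nat \<Rightarrow> complex \<Rightarrow> complex" where
  "joint_transform \<Omega> X J i s =
     (LINT \<omega>|\<Omega>. exp (- s * complex_of_real (X \<omega>)) * of_bool (J \<omega> = i))"

definition limit_transform ::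
  "'w measure \<Rightarrow> (nat \<Rightarrow> 'w \<Rightarrow> real) \<Rightarrow> (nat \<Rightarrow> 'w \<Rightarrow> nat) \<Rightarrow> nat \<Rightarrow> complex \<Rightarrow> complex" where
  "limit_transform \<Omega> W Y i s = lim (\<lambda>n. joint_transform \<Omega> (W n) (Y n) i s)"

(* \<Omega> carries the process, \<Omega>' the steady-state pair (Winf, Yinf). The variable A 0 plays no role. *)
locale modulated_workload = prob_space \<Omega> + steady: prob_space \<Omega>'
  for \<Omega> :: "'w measure" and \<Omega>' :: "'v measure" +
  fixes N :: nat and a :: real
    and p :: "nat \<Rightarrow> nat \<Rightarrow> real" and \<pi> :: "nat \<Rightarrow> real"
    and Y :: "nat \<Rightarrow> 'w \<Rightarrow> nat"
    and W S A :: "nat \<Rightarrow> 'w \<Rightarrow> real"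
    and F :: "nat \<Rightarrow> real \<Rightarrow> real"
    and M :: nat and q :: "nat \<Rightarrow> real" and rate :: "nat \<Rightarrow> real"
    and Winf :: "'v \<Rightarrow> real" and Yinf :: "'v \<Rightarrow> nat"
  assumes a: "0 < a" "a < 1"
    and stochastic: "stochastic_on N p"
    and irreducible: "irreducible_on N p"
    and stationary: "stationary_distribution N p \<pi>"
    and F: "\<And>i. i \<in> {1..N} \<Longrightarrow> distribution_function_nonneg (F i)"
    and q: "\<And>m. m \<in> {1..M} \<Longrightarrow> 0 \<le> q m" "(\<Sum>m=1..M. q m) = 1"
    and rate: "\<And>j. j \<in> {1..N} \<Longrightarrow> 0 < rate j"
    and Y_measurable: "\<And>n. random_variable (count_space UNIV) (Y n)"
    and W_measurable: "\<And>n. random_variable borel (W n)"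
    and S_measurable: "\<And>n. random_variable borel (S n)"
    and A_measurable: "\<And>n. random_variable borel (A (Suc n))"
    and Y_range: "\<And>n \<omega>. \<omega> \<in> space \<Omega> \<Longrightarrow> Y n \<omega> \<in> {1..N}"
    and W_nonneg: "\<And>n \<omega>. \<omega> \<in> space \<Omega> \<Longrightarrow> 0 \<le> W n \<omega>"
    and S_nonneg: "\<And>n \<omega>. \<omega> \<in> space \<Omega> \<Longrightarrow> 0 \<le> S n \<omega>"
    and A_nonneg: "\<And>n \<omega>. \<omega> \<in> space \<Omega> \<Longrightarrow> 0 \<le> A (Suc n) \<omega>"
    and recursion: "\<And>n \<omega>. \<omega> \<in> space \<Omega> \<Longrightarrow>
      W (Suc n) \<omega> = max 0 (a * W n \<omega> + S n \<omega> - A (Suc n) \<omega>)"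
    and markov: "\<And>n y i j. \<lbrakk>i \<in> {1..N}; j \<in> {1..N};
        \<P>(\<omega> in \<Omega>. Y n \<omega> = i \<and> (\<forall>k<n. Y k \<omega> = y k)) > 0\<rbrakk> \<Longrightarrow>
      \<P>(\<omega> in \<Omega>. Y (Suc n) \<omega> = j \<bar> Y n \<omega> = i \<and> (\<forall>k<n. Y k \<omega> = y k)) = p i j"
    and joint_law: "\<And>n i j x y. \<lbrakk>i \<in> {1..N}; j \<in> {1..N}; 0 \<le> x; 0 \<le> y;
        \<P>(\<omega> in \<Omega>. Y n \<omega> = i) > 0\<rbrakk> \<Longrightarrow>
      \<P>(\<omega> in \<Omega>. A (Suc n) \<omega> \<le> x \<and> S n \<omega> \<le> y \<and> Y (Suc n) \<omega> = j \<bar> Y n \<omega> = i)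
        = p i j * F i y * mixed_erlang M q (rate j) x"
    and cond_indep: "\<And>n i C H. \<lbrakk>i \<in> {1..N};
        C \<in> sets (borel \<Otimes>\<^sub>M borel \<Otimes>\<^sub>M count_space UNIV); H \<in> sets (past \<Omega> Y W S A n);
        \<P>(\<omega> in \<Omega>. Y n \<omega> = i) > 0\<rbrakk> \<Longrightarrow>
      \<P>(\<omega> in \<Omega>. (A (Suc n) \<omega>, S n \<omega>, Y (Suc n) \<omega>) \<in> C \<and> \<omega> \<in> H \<bar> Y n \<omega> = i)
        = \<P>(\<omega> in \<Omega>. (A (Suc n) \<omega>, S n \<omega>, Y (Suc n) \<omega>) \<in> C \<bar> Y n \<omega> = i)
          * \<P>(\<omega> in \<Omega>. \<omega> \<in> H \<bar> Y n \<omega> = i)"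
    and Winf_measurable: "steady.random_variable borel Winf"
    and Yinf_measurable: "steady.random_variable (count_space UNIV) Yinf"
    and Winf_nonneg: "\<And>\<omega>. \<omega> \<in> space \<Omega>' \<Longrightarrow> 0 \<le> Winf \<omega>"
    and Yinf_law: "\<And>i. i \<in> {1..N} \<Longrightarrow> \<P>(\<omega> in \<Omega>'. Yinf \<omega> = i) = \<pi> i"
    and steady_state: "\<And>i s. \<lbrakk>i \<in> {1..N}; 0 \<le> Re s\<rbrakk> \<Longrightarrow>
      (\<lambda>n. joint_transform \<Omega> (W n) (Y n) i s) \<longlonglongrightarrow> joint_transform \<Omega>' Winf Yinf i s"

definition state_vec :: "nat \<Rightarrow> (nat \<Rightarrow> complex) \<Rightarrow> complex Matrix.vec" where
  "state_vec N z = Matrix.vec N (\<lambda>i. z (Suc i))"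

definition state_diagonal :: "nat \<Rightarrow> (nat \<Rightarrow> complex) \<Rightarrow> complex mat" where
  "state_diagonal N d = mat_diag N (\<lambda>i. d (Suc i))"

definition erlang_ratio :: "(nat \<Rightarrow> real) \<Rightarrow> nat \<Rightarrow> complex \<Rightarrow> complex" where
  "erlang_ratio rate j s = of_real (rate j) / (of_real (rate j) - s)"

(* The k-th derivative of the composite function u \<mapsto> Z i (a u) at u = r, with no chain-rule factor
   taken out. *)
definition scaled_deriv ::
  "(nat \<Rightarrow> complex \<Rightarrow> complex) \<Rightarrow> real \<Rightarrow> nat \<Rightarrow> nat \<Rightarrow> real \<Rightarrow> complex" where
  "scaled_deriv Z a k i r = (deriv ^^ k) (\<lambda>u. Z i (of_real a * u)) (of_real r)"

definition L_hat :: "nat \<Rightarrow> nat \<Rightarrow> (nat \<Rightarrow> real) \<Rightarrow> (nat \<Rightarrow> real) \<Rightarrow> complex \<Rightarrow> complex mat" where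
  "L_hat N M q rate s =
     state_diagonal N (\<lambda>j. \<Sum>m=1..M. of_real (q m) * erlang_ratio rate j s ^ m)"

definition H_hat ::
  "nat \<Rightarrow> (nat \<Rightarrow> nat \<Rightarrow> real) \<Rightarrow> nat \<Rightarrow> (nat \<Rightarrow> real) \<Rightarrow> (nat \<Rightarrow> real) \<Rightarrow>
   (nat \<Rightarrow> complex \<Rightarrow> complex) \<Rightarrow> complex \<Rightarrow> complex mat" where
  "H_hat N p M q rate \<beta> s =
     L_hat N M q rate s * transpose_mat (map_mat of_real (transition_mat N p))
       * state_diagonal N (\<lambda>i. \<beta> i s)"

definition v_coeff ::
  "nat \<Rightarrow> real \<Rightarrow> (nat \<Rightarrow> nat \<Rightarrow> real) \<Rightarrow> (nat \<Rightarrow> real) \<Rightarrow> (nat \<Rightarrow> complex \<Rightarrow> complex) \<Rightarrow>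
   (nat \<Rightarrow> complex \<Rightarrow> complex) \<Rightarrow> nat \<Rightarrow> nat \<Rightarrow> complex" where
  "v_coeff N a p rate Z \<beta> j l =
     (\<Sum>k=0..l. (- of_real (rate j)) ^ l / fact l * of_nat (l choose k) *
       (\<Sum>i=1..N. of_real (p i j) * scaled_deriv Z a k i (rate j)
                  * (deriv ^^ (l - k)) (\<beta> i) (of_real (rate j))))"

(* With rows numbered from 0, the 1-based exponent m - t + 1 becomes m - t. *)
definition A_mat :: "(nat \<Rightarrow> real) \<Rightarrow> nat \<Rightarrow> nat \<Rightarrow> complex \<Rightarrow> complex mat" where
  "A_mat rate j m s = mat_diag m (\<lambda>t. 1 - erlang_ratio rate j s ^ (m - t))"

definition V_hat ::
  "nat \<Rightarrow> real \<Rightarrow> (nat \<Rightarrow> nat \<Rightarrow> real) \<Rightarrow> nat \<Rightarrow> (nat \<Rightarrow> real) \<Rightarrow> (nat \<Rightarrow> real) \<Rightarrow>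
   (nat \<Rightarrow> complex \<Rightarrow> complex) \<Rightarrow> (nat \<Rightarrow> complex \<Rightarrow> complex) \<Rightarrow> complex \<Rightarrow>
   complex Matrix.vec" where
  "V_hat N a p M q rate Z \<beta> s =
     state_vec N (\<lambda>j. \<Sum>m=1..M. of_real (q m) *
       scalar_prod (Matrix.vec m (\<lambda>_. 1))
         (A_mat rate j m s *\<^sub>v Matrix.vec m (\<lambda>l. v_coeff N a p rate Z \<beta> j l)))"

end

theory Submission
  imports Defs "HOL-Complex_Analysis.Complex_Analysis"
begin

text \<open>
Condition on a transition from \<open>i\<close> to \<open>j\<close> at time \<open>n\<close>. The hypotheses make \<open>W n\<close>, the service time and
the interarrival time independent on this event (\<open>jump_law\<close>), so that with \<open>T = a W + S\<close> the new workload
is \<open>max 0 (T - A)\<close> for a mixed-Erlang \<open>A\<close> independent of \<open>T\<close>. For an Erlang variable with rate \<open>r\<close> and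
\<open>m\<close> phases and for fixed \<open>T = t\<close>, splitting the integral at \<open>A = t\<close> gives the elementary formula
(\<open>erlang_reflected_exp\<close>, with \<open>\<rho> = r / (r - s)\<close>)

  \<open>E exp (- s max 0 (t - A)) = \<rho> ^ m exp (- s t) + (\<Sum>l<m. (r t) ^ l / l! exp (- r t) (1 - \<rho> ^ (m - l)))\<close>.

Now average over \<open>T\<close>. The first term gives the transform of \<open>T\<close> at \<open>s\<close>, a product of the scaled workload
transform and \<open>\<beta>\<close> by independence. In the second, \<open>T ^ l exp (- r T)\<close> averages to
\<open>(- 1) ^ l\<close> times the \<open>l\<close>th derivative of that product at \<open>r\<close> (\<open>higher_deriv_laplace\<close>). Summing over
\<open>i\<close> gives an exact equation between times \<open>n + 1\<close> and \<open>n\<close> (\<open>one_step_transform\<close>).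

It remains to let \<open>n\<close> tend to infinity. The transforms converge pointwise on the closed right half-plane.
They are also holomorphic and bounded by 1 near \<open>r\<close>, so their derivatives at \<open>r\<close> converge as well, by
Cauchy's integral formula and dominated convergence (\<open>higher_deriv_tendsto_of_bounded_pointwise\<close>). The
Leibniz rule then splits the \<open>l\<close>th derivative of the limiting product into the binomial sum of the statement. The
matrix equation is the same family of identities after an exchange of finite sums.
\<close>

section \<open>Laplace transforms of nonnegative random variables\<close>

definition laplace :: "'a measure \<Rightarrow> ('a \<Rightarrow> real) \<Rightarrow> complex \<Rightarrow> complex" where
  "laplace M X s = (LINT \<omega>|M. exp (- s * complex_of_real (X \<omega>)))"

lemma norm_exp_nonpos_le_1:
  assumes "0 \<le> x" "0 \<le> Re s"
  shows "norm (exp (- s * complex_of_real x)) \<le> 1"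
  using assms by (simp add: norm_exp_eq_Re)

lemma integrable_exp_laplace:
  assumes "finite_measure M" and [measurable]: "X \<in> borel_measurable M"
    and "AE \<omega> in M. 0 \<le> X \<omega>" and "0 \<le> Re s"
  shows "integrable M (\<lambda>\<omega>. exp (- s * complex_of_real (X \<omega>)))"
proof -
  interpret finite_measure M by fact
  show ?thesis
    by (rule integrable_const_bound[where B=1, OF eventually_mono[OF assms(3) norm_exp_nonpos_le_1[OF _ assms(4)]]])
      auto
qed

lemma norm_laplace_le:
  assumes "finite_measure M" and [measurable]: "X \<in> borel_measurable M"
    and "AE \<omega> in M. 0 \<le> X \<omega>" and "0 \<le> Re s"
  shows "norm (laplace M X s) \<le> measure M (space M)"
proof -
  interpret finite_measure M by fact
  have "norm (laplace M X s) \<le> (LINT \<omega>|M. norm (exp (- s * complex_of_real (X \<omega>))))"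
    unfolding laplace_def by (rule integral_norm_bound)
  also have "\<dots> \<le> (LINT \<omega>|M. 1)"
    by (intro integral_mono_AE integrable_norm integrable_exp_laplace assms
          eventually_mono[OF assms(3) norm_exp_nonpos_le_1[OF _ assms(4)]]) auto
  finally show ?thesis by simp
qed

lemma power_exp_term_sums:
  fixes d :: complex and r x :: real
  shows "(\<lambda>k. (- of_real x) ^ k / fact k * exp (- of_real r * of_real x) * d ^ k)
           sums exp (- (of_real r + d) * of_real x)"
proof -
  have "(\<lambda>k. (- d * of_real x) ^ k /\<^sub>R fact k * exp (- of_real r * of_real x))
      sums (exp (- d * of_real x) * exp (- of_real r * of_real x))"
    by (intro sums_mult2 exp_converges)
  also have "(\<lambda>k. (- d * of_real x) ^ k /\<^sub>R fact k * exp (- of_real r * of_real x))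
     = (\<lambda>k. (- of_real x) ^ k / fact k * exp (- of_real r * of_real x) * d ^ k)"
  proof
    fix k
    have "(- d * of_real x) ^ k = (- of_real x) ^ k * d ^ k"
      by (simp add: power_mult_distrib[symmetric] mult.commute)
    then show "(- d * of_real x) ^ k /\<^sub>R fact k * exp (- of_real r * of_real x)
       = (- of_real x) ^ k / fact k * exp (- of_real r * of_real x) * d ^ k"
      by (simp add: scaleR_conv_of_real field_simps)
  qed
  also have "exp (- d * of_real x) * exp (- of_real r * of_real x) = exp (- (of_real r + d) * of_real x)"
    by (simp add: exp_add[symmetric] algebra_simps)
  finally show ?thesis .
qed

text \<open>Expand the exponential around a real point \<open>r > 0\<close>: the factor \<open>exp (- d X)\<close> becomes a power
series in \<open>d\<close>. Sum and integral may be exchanged because the absolute values add up to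
\<open>exp (- (r - |d|) X)\<close>, which is at most 1.\<close>

lemma laplace_power_series:
  assumes "finite_measure M" and [measurable]: "X \<in> borel_measurable M"
    and nonneg: "AE \<omega> in M. 0 \<le> X \<omega>" and d: "norm d < r"
  shows "(\<lambda>k. (LINT \<omega>|M. (- of_real (X \<omega>)) ^ k * exp (- of_real r * of_real (X \<omega>))) / fact k * d ^ k)
           sums laplace M X (of_real r + d)"
    and "integrable M (\<lambda>\<omega>. (- complex_of_real (X \<omega>)) ^ k * exp (- of_real r * of_real (X \<omega>)))"
proof -
  interpret finite_measure M by fact
  have r: "0 < r" using d norm_ge_zero[of d] by linarith
  define g where "g = (\<lambda>(e::complex) k \<omega>. (- of_real (X \<omega>)) ^ k / fact k * exp (- of_real r * of_real (X \<omega>)) * e ^ k)"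
  have g_meas [measurable]: "g e k \<in> borel_measurable M" for e k
    unfolding g_def by measurable
  have norm_g: "norm (g e k \<omega>) = X \<omega> ^ k / fact k * exp (- r * X \<omega>) * norm e ^ k"
    if "0 \<le> X \<omega>" for e k \<omega>
    using that by (simp add: g_def norm_mult norm_divide norm_power norm_exp_eq_Re)
  have sum_g: "(\<lambda>k. norm (g e k \<omega>)) sums exp (- (r - norm e) * X \<omega>)"
    if "0 \<le> X \<omega>" for e \<omega>
  proof -
    have "(\<lambda>k. (norm e * X \<omega>) ^ k /\<^sub>R fact k * exp (- r * X \<omega>)) sums (exp (norm e * X \<omega>) * exp (- r * X \<omega>))"
      by (intro sums_mult2 exp_converges)
    also have "exp (norm e * X \<omega>) * exp (- r * X \<omega>) = exp (- (r - norm e) * X \<omega>)"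
      by (simp add: exp_add[symmetric] algebra_simps)
    also have "(\<lambda>k. (norm e * X \<omega>) ^ k /\<^sub>R fact k * exp (- r * X \<omega>)) = (\<lambda>k. norm (g e k \<omega>))"
      by (simp add: norm_g[OF that] power_mult_distrib field_simps)
    finally show ?thesis .
  qed
  have partial: "(\<Sum>k\<in>K. norm (g e k \<omega>)) \<le> 1" if "0 \<le> X \<omega>" "norm e < r" "finite K" for e \<omega> K
  proof -
    have "(\<Sum>k\<in>K. norm (g e k \<omega>)) \<le> (\<Sum>k. norm (g e k \<omega>))"
      using sum_g[OF that(1)] that(3) by (intro sum_le_suminf) (auto simp: sums_iff)
    also have "\<dots> = exp (- (r - norm e) * X \<omega>)"
      using sum_g[OF that(1)] by (simp add: sums_iff)
    also have "\<dots> \<le> 1" using that by (simp add: mult_nonpos_nonneg)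
    finally show ?thesis .
  qed
  \<comment> \<open>Stated for all e and not just d: at d = 0 the terms with k > 0 vanish, so the integrability of the
    moments is taken from e = r / 2 below.\<close>
  have int: "integrable M (g e k)" if "norm e < r" for e k
    by (rule integrable_const_bound[where B=1])
      (use nonneg partial[of _ e "{k}"] that in \<open>auto elim!: eventually_mono\<close>)
  have "(\<lambda>k. integral\<^sup>L M (g d k)) sums (\<integral>\<omega>. (\<Sum>k. g d k \<omega>) \<partial>M)"
  proof (rule sums_integral)
    show "integrable M (g d k)" for k using int[OF d] .
    show "AE \<omega> in M. summable (\<lambda>k. norm (g d k \<omega>))"
      using nonneg sum_g by (auto elim!: eventually_mono simp: sums_iff)
    show "summable (\<lambda>k. \<integral>\<omega>. norm (g d k \<omega>) \<partial>M)"
    proof (rule bounded_imp_summable)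
      fix n
      have "(\<Sum>k\<le>n. \<integral>\<omega>. norm (g d k \<omega>) \<partial>M) = (\<integral>\<omega>. (\<Sum>k\<le>n. norm (g d k \<omega>)) \<partial>M)"
        using int[OF d] by (intro Bochner_Integration.integral_sum[symmetric]) auto
      also have "\<dots> \<le> (\<integral>\<omega>. 1 \<partial>M)"
        using nonneg partial[OF _ d] int[OF d]
        by (intro integral_mono_AE) (auto elim!: eventually_mono)
      finally show "(\<Sum>k\<le>n. \<integral>\<omega>. norm (g d k \<omega>) \<partial>M) \<le> (\<integral>\<omega>. 1 \<partial>M)" .
    qed auto
  qed
  also have "(\<integral>\<omega>. (\<Sum>k. g d k \<omega>) \<partial>M) = laplace M X (of_real r + d)"
    unfolding laplace_def g_def using power_exp_term_sums by (simp add: sums_iff)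
  finally have *: "(\<lambda>k. integral\<^sup>L M (g d k)) sums laplace M X (of_real r + d)" .
  have "integral\<^sup>L M (g d k) = (LINT \<omega>|M. (- of_real (X \<omega>)) ^ k * exp (- of_real r * of_real (X \<omega>))) / fact k * d ^ k" for k
  proof -
    have "g d k = (\<lambda>\<omega>. (- of_real (X \<omega>)) ^ k * exp (- of_real r * of_real (X \<omega>)) / fact k * d ^ k)"
      by (auto simp: g_def)
    then show ?thesis by simp
  qed
  with * show "(\<lambda>k. (LINT \<omega>|M. (- of_real (X \<omega>)) ^ k * exp (- of_real r * of_real (X \<omega>))) / fact k * d ^ k)
           sums laplace M X (of_real r + d)" by simp
  have "integrable M (\<lambda>\<omega>. (fact k / of_real (r/2) ^ k) * g (of_real (r/2)) k \<omega>)"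
    using int[of "of_real (r/2)" k] r by (intro integrable_mult_right) simp
  also have "(\<lambda>\<omega>. (fact k / of_real (r/2) ^ k) * g (of_real (r/2)) k \<omega>)
      = (\<lambda>\<omega>. (- complex_of_real (X \<omega>)) ^ k * exp (- of_real r * of_real (X \<omega>)))"
    using r by (auto simp: g_def)
  finally show "integrable M (\<lambda>\<omega>. (- complex_of_real (X \<omega>)) ^ k * exp (- of_real r * of_real (X \<omega>)))" .
qed

text \<open>The ball of radius \<open>r\<close> around \<open>r\<close> is the largest one around \<open>r\<close> inside the right half-plane. It
is enough for all derivatives at \<open>r\<close>.\<close>

lemma laplace_holomorphic:
  assumes "finite_measure M" "X \<in> borel_measurable M" "AE \<omega> in M. 0 \<le> X \<omega>"
  shows "laplace M X holomorphic_on ball (of_real r) r"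
proof (rule power_series_holomorphic)
  fix w assume "w \<in> ball (complex_of_real r) r"
  then have "norm (w - of_real r) < r" by (simp add: dist_norm norm_minus_commute)
  from laplace_power_series(1)[OF assms this]
  show "(\<lambda>k. (LINT \<omega>|M. (- of_real (X \<omega>)) ^ k * exp (- of_real r * of_real (X \<omega>))) / fact k * (w - of_real r) ^ k)
          sums laplace M X w" by simp
qed

text \<open>The derivatives are read off as coefficients of the power series, which avoids differentiating
under the integral.\<close>

lemma higher_deriv_laplace:
  assumes "finite_measure M" "X \<in> borel_measurable M" "AE \<omega> in M. 0 \<le> X \<omega>" and r: "0 < r"
  shows "(deriv ^^ k) (laplace M X) (of_real r)
           = (LINT \<omega>|M. (- of_real (X \<omega>)) ^ k * exp (- of_real r * of_real (X \<omega>)))"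
proof -
  define c :: "nat \<Rightarrow> complex" where "c k = (LINT \<omega>|M. (- of_real (X \<omega>)) ^ k * exp (- of_real r * of_real (X \<omega>))) / fact k" for k
  have "(\<lambda>d. laplace M X (of_real r + d)) has_fps_expansion Abs_fps c"
  proof (rule has_fps_expansionI)
    have "eventually (\<lambda>d::complex. d \<in> ball 0 r) (nhds 0)"
      using r by (intro eventually_nhds_in_open) auto
    then show "\<forall>\<^sub>F d in nhds 0. (\<lambda>n. fps_nth (Abs_fps c) n * d ^ n) sums laplace M X (of_real r + d)"
      by eventually_elim (use laplace_power_series(1)[OF assms(1-3)] in \<open>simp add: c_def\<close>)
  qed
  from fps_nth_fps_expansion[OF this, of k]
  have "c k = (deriv ^^ k) (\<lambda>d. laplace M X (of_real r + d)) 0 / fact k" by simp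
  also have "(deriv ^^ k) (\<lambda>d. laplace M X (of_real r + d)) 0 = (deriv ^^ k) (laplace M X) (of_real r)"
    by (simp add: higher_deriv_shift_0' o_def)
  finally show ?thesis by (simp add: c_def)
qed

section \<open>Convergence of derivatives\<close>

text \<open>A weak form of Vitali's theorem. Cauchy's formula writes the derivative at the centre as an integral
over a smaller circle, on which dominated convergence applies because of the uniform bound. This is what
carries the limit in \<open>n\<close> past the derivatives in the workload equation.\<close>

lemma higher_deriv_tendsto_of_bounded_pointwise:
  fixes f :: "nat \<Rightarrow> complex \<Rightarrow> complex"
  assumes R: "0 < R"
    and holf: "\<And>n. f n holomorphic_on ball z R" and holg: "g holomorphic_on ball z R"
    and bound: "\<And>n w. w \<in> ball z R \<Longrightarrow> norm (f n w) \<le> B"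
    and lim: "\<And>w. w \<in> ball z R \<Longrightarrow> (\<lambda>n. f n w) \<longlonglongrightarrow> g w"
  shows "(\<lambda>n. (deriv ^^ k) (f n) z) \<longlonglongrightarrow> (deriv ^^ k) g z"
proof -
  define r where "r = R / 2"
  have r: "0 < r" "r < R" using R by (auto simp: r_def)
  have sub: "cball z r \<subseteq> ball z R" using r by auto
  \<comment> \<open>The part of the Cauchy integrand that does not depend on the function.\<close>
  define K where "K = (\<lambda>x. vector_derivative (circlepath z r) (at x) / (circlepath z r x - z) ^ Suc k)"
  have circ: "circlepath z r x \<in> ball z R" "norm (circlepath z r x - z) = r" for x
    using r by (auto simp: circlepath dist_norm norm_mult)
  have cauchy: "((\<lambda>x. h (circlepath z r x) * K x) has_integral
      (2 * pi * \<i>) / fact k * (deriv ^^ k) h z) {0..1}"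
    if "h holomorphic_on ball z R" for h
  proof -
    have "((\<lambda>u. h u / (u - z) ^ Suc k) has_contour_integral (2 * pi * \<i>) / fact k * (deriv ^^ k) h z) (circlepath z r)"
      using r sub that
      by (intro Cauchy_has_contour_integral_higher_derivative_circlepath)
        (auto intro: holomorphic_on_subset holomorphic_on_imp_continuous_on)
    then show ?thesis
      by (simp add: has_contour_integral K_def vector_derivative_circlepath01 mult_ac)
  qed
  have K_bound: "norm (K x) \<le> 2 * pi * r / r ^ Suc k" for x
    unfolding K_def norm_divide norm_power circ(2) using r
    by (simp add: vector_derivative_circlepath norm_mult)
  have "(\<lambda>n. integral {0..1} (\<lambda>x. f n (circlepath z r x) * K x)) \<longlonglongrightarrow> integral {0..1} (\<lambda>x. g (circlepath z r x) * K x)"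
  proof (rule dominated_convergence(2))
    show "(\<lambda>x. f n (circlepath z r x) * K x) integrable_on {0..1}" for n
      using cauchy[OF holf] by blast
    show "(\<lambda>x. B * (2 * pi * r / r ^ Suc k)) integrable_on {0..1::real}"
      by (rule integrable_const_ivl)
    show "norm (f n (circlepath z r x) * K x) \<le> B * (2 * pi * r / r ^ Suc k)" for n x
      unfolding norm_mult
      using bound[OF circ(1)] K_bound by (intro mult_mono) (auto intro: order_trans[OF norm_ge_zero])
    show "(\<lambda>n. f n (circlepath z r x) * K x) \<longlonglongrightarrow> g (circlepath z r x) * K x" for x
      by (intro tendsto_intros lim circ)
  qed
  then have "(\<lambda>n. (2 * pi * \<i>) / fact k * (deriv ^^ k) (f n) z) \<longlonglongrightarrow> (2 * pi * \<i>) / fact k * (deriv ^^ k) g z"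
    by (simp only: integral_unique[OF cauchy[OF holf]] integral_unique[OF cauchy[OF holg]])
  from tendsto_mult[OF tendsto_const[of "fact k / (2 * pi * \<i>)"] this]
  show ?thesis by simp
qed

section \<open>Subtracting an Erlang variable and reflecting at 0\<close>

lemma exp_partial_sum_deriv:
  fixes z :: complex
  shows "((\<lambda>z. (\<Sum>l\<le>k. z ^ l / fact l) * exp (- z)) has_field_derivative - (z ^ k / fact k * exp (- z))) (at z)"
proof (induction k)
  case 0
  show ?case by (auto intro!: derivative_eq_intros)
next
  case (Suc k)
  have "((\<lambda>z. (\<Sum>l\<le>k. z ^ l / fact l) * exp (- z) + z ^ Suc k / fact (Suc k) * exp (- z)) has_field_derivative
      - (z ^ k / fact k * exp (- z)) + (of_nat (Suc k) * z ^ k / fact (Suc k) * exp (- z)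
        - z ^ Suc k / fact (Suc k) * exp (- z))) (at z)"
    by (rule DERIV_add[OF Suc]) (auto intro!: derivative_eq_intros simp: diff_divide_distrib mult_ac simp del: power_Suc of_nat_Suc fact_Suc)
  also have "of_nat (Suc k) * z ^ k / fact (Suc k) = z ^ k / fact k"
    using of_nat_neq_0[of k, where 'a=complex] unfolding fact_Suc by (simp del: of_nat_Suc)
  finally show ?case by (simp add: algebra_simps del: power_Suc of_nat_Suc fact_Suc)
qed

text \<open>The part of the Erlang integral in which the subtracted variable does not exceed \<open>t\<close>. With
\<open>\<kappa> = r - s\<close> the integrand is a multiple of \<open>x ^ k exp (- \<kappa> x)\<close>, whose antiderivative is the
Erlang tail with the complex rate \<open>\<kappa>\<close>.\<close>

lemma tilted_erlang_integral:
  fixes s :: complex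
  assumes t: "0 \<le> t" and s: "s \<noteq> of_real r"
  defines "\<rho> \<equiv> of_real r / (of_real r - s)"
  shows "(LINT x|lborel. indicator {0..t} x *\<^sub>R
            (of_real (erlang_density k r x) * exp (- s * of_real (t - x))))
        = \<rho> ^ Suc k * exp (- s * of_real t)
          - (\<Sum>l\<le>k. (of_real (r * t)) ^ l / fact l * exp (- of_real (r * t)) * \<rho> ^ (Suc k - l))"
proof -
  define \<kappa> where "\<kappa> = of_real r - s"
  have \<kappa>: "\<kappa> \<noteq> 0" using s by (auto simp: \<kappa>_def)
  have \<rho>\<kappa>: "\<rho> * \<kappa> = of_real r" using \<kappa> by (simp add: \<rho>_def \<kappa>_def)
  define T where "T = (\<lambda>z::complex. (\<Sum>l\<le>k. z ^ l / fact l) * exp (- z))"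
  \<comment> \<open>The factor makes the derivative of \<Phi> equal to the density times the exponential, since
    \<rho> ^ Suc k * \<kappa> ^ Suc k = r ^ Suc k.\<close>
  define \<Phi> where "\<Phi> = (\<lambda>x::real. - (\<rho> ^ Suc k * exp (- s * of_real t) * T (\<kappa> * of_real x)))"
  define f where "f = (\<lambda>x::real. of_real (r ^ Suc k * x ^ k * exp (- r * x) / fact k) * exp (- s * of_real (t - x)))"
  have f: "f x = \<rho> ^ Suc k * exp (- s * of_real t) * (\<kappa> * ((\<kappa> * of_real x) ^ k / fact k * exp (- (\<kappa> * of_real x))))" for x
  proof -
    have E: "exp (- s * of_real t) * exp (- (\<kappa> * of_real x)) = of_real (exp (- r * x)) * exp (- s * of_real (t - x))"
    proof -
      have "- s * of_real t + - (\<kappa> * of_real x) = of_real (- r * x) + - s * of_real (t - x)"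
        by (simp add: \<kappa>_def algebra_simps)
      then show ?thesis unfolding exp_of_real[symmetric] exp_add[symmetric] by simp
    qed
    have P: "\<rho> ^ Suc k * (\<kappa> * (\<kappa> * of_real x) ^ k) = (of_real r) ^ Suc k * of_real x ^ k"
      by (simp only: \<rho>\<kappa>[symmetric] power_mult_distrib power_Suc mult_ac)
    have "f x = (of_real r ^ Suc k * of_real x ^ k) * (of_real (exp (- r * x)) * exp (- s * of_real (t - x))) / fact k"
      unfolding f_def of_real_mult of_real_divide of_real_power of_real_fact
      by (simp only: times_divide_eq_left times_divide_eq_right mult.assoc)
    also have "\<dots> = (\<rho> ^ Suc k * (\<kappa> * (\<kappa> * of_real x) ^ k)) * (exp (- s * of_real t) * exp (- (\<kappa> * of_real x))) / fact k"
      unfolding E P ..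
    finally show ?thesis by (simp only: mult_ac times_divide_eq_left times_divide_eq_right)
  qed
  have "(LINT x|lborel. indicator {0..t} x *\<^sub>R f x) = \<Phi> t - \<Phi> 0"
  proof (rule integral_FTC_atLeastAtMost[OF t])
    show "(\<Phi> has_vector_derivative f x) (at x within {0..t})" for x
    proof -
      have "((\<lambda>z. - (\<rho> ^ Suc k * exp (- s * of_real t) * T (\<kappa> * z))) has_field_derivative
          - (\<rho> ^ Suc k * exp (- s * of_real t) * (- ((\<kappa> * of_real x) ^ k / fact k * exp (- (\<kappa> * of_real x))) * \<kappa>)))
          (at (of_real x))"
        unfolding T_def
        by (intro DERIV_minus DERIV_cmult DERIV_chain2[OF exp_partial_sum_deriv]) (auto intro!: derivative_eq_intros)
      from has_vector_derivative_real_field[OF this]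
      show ?thesis unfolding \<Phi>_def f by (simp add: mult_ac)
    qed
    show "continuous_on {0..t} f" unfolding f_def by (intro continuous_intros) auto
  qed
  also have "(\<lambda>x. indicator {0..t} x *\<^sub>R f x) = (\<lambda>x. indicator {0..t} x *\<^sub>R
            (of_real (erlang_density k r x) * exp (- s * of_real (t - x))))"
    by (auto simp: fun_eq_iff f_def erlang_density_def indicator_def)
  also have "T 0 = 1"
    unfolding T_def by (simp add: power_0_left atMost_atLeast0 sum.atLeast_Suc_atMost)
  then have "\<Phi> t - \<Phi> 0 = \<rho> ^ Suc k * exp (- s * of_real t) - \<rho> ^ Suc k * exp (- s * of_real t) * T (\<kappa> * of_real t)"
    by (simp add: \<Phi>_def)
  also have "\<rho> ^ Suc k * exp (- s * of_real t) * T (\<kappa> * of_real t)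
      = (\<Sum>l\<le>k. (of_real (r * t)) ^ l / fact l * exp (- of_real (r * t)) * \<rho> ^ (Suc k - l))"
    unfolding T_def sum_distrib_right sum_distrib_left
  proof (rule sum.cong[OF refl])
    fix l assume "l \<in> {..k}"
    then have split: "\<rho> ^ Suc k = \<rho> ^ (Suc k - l) * \<rho> ^ l" by (simp only: power_add[symmetric]) simp
    have P: "\<rho> ^ l * (\<kappa> * of_real t) ^ l = (of_real (r * t)) ^ l"
      by (simp only: \<rho>\<kappa>[symmetric] of_real_mult power_mult_distrib mult_ac)
    have E: "exp (- s * of_real t) * exp (- (\<kappa> * of_real t)) = exp (- of_real (r * t))"
      unfolding exp_add[symmetric] by (simp add: \<kappa>_def algebra_simps)
    have "\<rho> ^ Suc k * exp (- s * of_real t) * ((\<kappa> * of_real t) ^ l / fact l * exp (- (\<kappa> * of_real t)))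
      = (\<rho> ^ l * (\<kappa> * of_real t) ^ l) / fact l * (exp (- s * of_real t) * exp (- (\<kappa> * of_real t))) * \<rho> ^ (Suc k - l)"
      unfolding split by (simp only: mult_ac times_divide_eq_left times_divide_eq_right)
    then show "\<rho> ^ Suc k * exp (- s * of_real t) * ((\<kappa> * of_real t) ^ l / fact l * exp (- (\<kappa> * of_real t)))
      = (of_real (r * t)) ^ l / fact l * exp (- of_real (r * t)) * \<rho> ^ (Suc k - l)"
      unfolding P E .
  qed
  finally show ?thesis .
qed

text \<open>Beyond \<open>t\<close> the reflected difference is 0, so the exponential is 1 and only the tail probability of the
Erlang law remains. The tail is a sum over the same terms \<open>(r t) ^ l exp (- r t) / l!\<close> that the
integral over \<open>{0..t}\<close> produces, and the two contributions merge into the factors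
\<open>1 - \<rho> ^ (Suc k - l)\<close>.\<close>

lemma erlang_reflected_exp:
  fixes s :: complex
  assumes r: "0 < r" and t: "0 \<le> t" and Re: "0 \<le> Re s" and s: "s \<noteq> of_real r"
  defines "\<rho> \<equiv> of_real r / (of_real r - s)"
  shows "(LINT x|lborel. of_real (erlang_density k r x) * exp (- s * of_real (max 0 (t - x))))
        = \<rho> ^ Suc k * exp (- s * of_real t)
          + (\<Sum>l\<le>k. (of_real (r * t)) ^ l / fact l * exp (- of_real (r * t)) * (1 - \<rho> ^ (Suc k - l)))"
    and "integrable lborel (\<lambda>x. of_real (erlang_density k r x) * exp (- s * of_real (max 0 (t - x))))"
proof -
  let ?D = "density lborel (erlang_density k r)"
  let ?f = "\<lambda>x. of_real (erlang_density k r x) * exp (- s * of_real (max 0 (t - x)))"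
  interpret D: prob_space ?D by (rule prob_space_erlang_density[OF r])
  have "integrable ?D (\<lambda>x. exp (- s * of_real (max 0 (t - x))))"
    by (rule integrable_exp_laplace) (use Re in \<open>auto intro: D.finite_measure_axioms\<close>)
  then show int: "integrable lborel ?f"
    using r by (subst (asm) integrable_density) (auto simp: scaleR_conv_of_real)
  have split: "?f x = indicator {0..t} x *\<^sub>R (of_real (erlang_density k r x) * exp (- s * of_real (t - x)))
      + of_real (indicator {t<..} x * erlang_density k r x)" for x
    using t by (auto simp: indicator_def erlang_density_def max_def not_le not_less)
  have int1: "integrable lborel (\<lambda>x. indicator {0..t} x *\<^sub>R (of_real (erlang_density k r x) * exp (- s * of_real (t - x))))"
  proof -
    have "integrable lborel (\<lambda>x. indicator {0..t} x *\<^sub>R ?f x)"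
      by (rule integrable_mult_indicator[OF _ int]) simp
    also have "(\<lambda>x. indicator {0..t} x *\<^sub>R ?f x)
        = (\<lambda>x. indicator {0..t} x *\<^sub>R (of_real (erlang_density k r x) * exp (- s * of_real (t - x))))"
      by (auto simp: indicator_def fun_eq_iff)
    finally show ?thesis .
  qed
  have int_dens: "integrable lborel (erlang_density k r)"
    using D.integrable_const[of "1::real"] r by (subst (asm) integrable_density) auto
  then have int2: "integrable lborel (\<lambda>x. indicator {t<..} x * erlang_density k r x)"
    using integrable_mult_indicator[of "{t<..}" lborel "erlang_density k r"] by simp
  have tail: "(LINT x|lborel. indicator {t<..} x * erlang_density k r x)
      = (\<Sum>l\<le>k. (r * t) ^ l / fact l * exp (- (r * t)))"
  proof -
    have "(LINT x|lborel. indicator {t<..} x * erlang_density k r x) = (LINT x|?D. indicator {t<..} x)"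
      using r by (subst integral_density) (auto simp: mult.commute)
    also have "\<dots> = measure ?D {t<..}" by simp
    also have "\<dots> = measure ?D (space ?D - {..t})" by (rule arg_cong[where f="measure ?D"]) auto
    also have "measure ?D (space ?D - {..t}) = 1 - measure ?D {..t}"
      using D.prob_space by (subst D.finite_measure_compl) auto
    also have "measure ?D {..t} = erlang_CDF k r t"
      using r by (simp add: measure_def emeasure_erlang_density)
    finally show ?thesis using t by (simp add: erlang_CDF_def)
  qed
  have "(LINT x|lborel. ?f x) = (LINT x|lborel. indicator {0..t} x *\<^sub>R (of_real (erlang_density k r x) * exp (- s * of_real (t - x))))
      + (LINT x|lborel. of_real (indicator {t<..} x * erlang_density k r x))"
    unfolding split by (rule Bochner_Integration.integral_add[OF int1 integrable_of_real[OF int2]])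
  also have "(LINT x|lborel. complex_of_real (indicator {t<..} x * erlang_density k r x))
      = (\<Sum>l\<le>k. (of_real (r * t)) ^ l / fact l * exp (- of_real (r * t)))"
    unfolding integral_complex_of_real tail by (simp add: exp_of_real[symmetric])
  finally show "(LINT x|lborel. ?f x) = \<rho> ^ Suc k * exp (- s * of_real t)
          + (\<Sum>l\<le>k. (of_real (r * t)) ^ l / fact l * exp (- of_real (r * t)) * (1 - \<rho> ^ (Suc k - l)))"
    unfolding tilted_erlang_integral[OF t s] \<rho>_def[symmetric]
    by (simp add: right_diff_distrib sum_subtractf)
qed

definition mixed_erlang_law :: "nat \<Rightarrow> (nat \<Rightarrow> real) \<Rightarrow> real \<Rightarrow> real measure" where
  "mixed_erlang_law M q r = density lborel (\<lambda>x. ennreal (\<Sum>m=1..M. q m * erlang_density (m - 1) r x))"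

lemma sets_mixed_erlang_law [simp, measurable_cong]: "sets (mixed_erlang_law M q r) = sets borel"
  by (simp add: mixed_erlang_law_def)

lemma space_mixed_erlang_law [simp]: "space (mixed_erlang_law M q r) = UNIV"
  by (simp add: mixed_erlang_law_def)

lemma emeasure_mixed_erlang_law:
  assumes r: "0 < r" and q: "\<And>m. m \<in> {1..M} \<Longrightarrow> 0 \<le> q m" and B: "B \<in> sets borel"
  shows "emeasure (mixed_erlang_law M q r) B
      = (\<Sum>m=1..M. ennreal (q m) * emeasure (density lborel (erlang_density (m - 1) r)) B)"
proof -
  have *: "ennreal (\<Sum>m=1..M. q m * erlang_density (m - 1) r x)
      = (\<Sum>m=1..M. ennreal (q m) * ennreal (erlang_density (m - 1) r x))" for x
    using r q by (subst sum_ennreal[symmetric]) (auto simp: ennreal_mult intro!: sum.cong)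
  have "emeasure (mixed_erlang_law M q r) B
      = (\<integral>\<^sup>+x. (\<Sum>m=1..M. ennreal (q m) * (ennreal (erlang_density (m - 1) r x) * indicator B x)) \<partial>lborel)"
    unfolding mixed_erlang_law_def *
    using B by (subst emeasure_density) (auto simp: sum_distrib_right mult.assoc simp del: sum_ennreal)
  also have "\<dots> = (\<Sum>m=1..M. \<integral>\<^sup>+x. ennreal (q m) * (ennreal (erlang_density (m - 1) r x) * indicator B x) \<partial>lborel)"
    using B by (intro nn_integral_sum) auto
  also have "\<dots> = (\<Sum>m=1..M. ennreal (q m) * emeasure (density lborel (erlang_density (m - 1) r)) B)"
    using B by (intro sum.cong refl) (simp add: nn_integral_cmult emeasure_density)
  finally show ?thesis .
qed

lemma prob_space_mixed_erlang_law:
  assumes r: "0 < r" and q: "\<And>m. m \<in> {1..M} \<Longrightarrow> 0 \<le> q m" "(\<Sum>m=1..M. q m) = 1"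
  shows "prob_space (mixed_erlang_law M q r)"
proof
  have "emeasure (density lborel (erlang_density (m - 1) r)) UNIV = 1" for m
    using prob_space.emeasure_space_1[OF prob_space_erlang_density[OF r]] by simp
  moreover have "emeasure (mixed_erlang_law M q r) UNIV
      = (\<Sum>m=1..M. ennreal (q m) * emeasure (density lborel (erlang_density (m - 1) r)) UNIV)"
    by (rule emeasure_mixed_erlang_law[OF r q(1)]) auto
  ultimately have "emeasure (mixed_erlang_law M q r) UNIV = (\<Sum>m=1..M. ennreal (q m))"
    by simp
  also have "\<dots> = 1" using q by (subst sum_ennreal) auto
  finally show "emeasure (mixed_erlang_law M q r) (space (mixed_erlang_law M q r)) = 1"
    by simp
qed

lemma measure_mixed_erlang_law_atMost:
  assumes r: "0 < r" and q: "\<And>m. m \<in> {1..M} \<Longrightarrow> 0 \<le> q m"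
  shows "measure (mixed_erlang_law M q r) {..x} = (if x < 0 then 0 else mixed_erlang M q r x)"
proof -
  have "emeasure (mixed_erlang_law M q r) {..x} = (\<Sum>m=1..M. ennreal (q m * erlang_CDF (m - 1) r x))"
  proof -
    have "emeasure (mixed_erlang_law M q r) {..x}
        = (\<Sum>m=1..M. ennreal (q m) * emeasure (density lborel (erlang_density (m - 1) r)) {..x})"
      by (rule emeasure_mixed_erlang_law[OF r q]) auto
    also have "\<dots> = (\<Sum>m=1..M. ennreal (q m * erlang_CDF (m - 1) r x))"
      using r q by (intro sum.cong refl) (simp add: emeasure_erlang_density ennreal_mult)
    finally show ?thesis .
  qed
  also have "\<dots> = ennreal (\<Sum>m=1..M. q m * erlang_CDF (m - 1) r x)"
    using r q by (intro sum_ennreal) auto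
  finally have "measure (mixed_erlang_law M q r) {..x} = (\<Sum>m=1..M. q m * erlang_CDF (m - 1) r x)"
    using r q unfolding measure_def by (subst enn2real_ennreal[symmetric]) (auto intro!: sum_nonneg)
  then show ?thesis
    by (auto simp: erlang_CDF_def mixed_erlang_def sum_distrib_left atMost_atLeast0 mult.commute intro!: sum.cong)
qed

lemma mixed_erlang_reflected_exp:
  fixes s :: complex
  assumes r: "0 < r" and q: "\<And>m. m \<in> {1..M} \<Longrightarrow> 0 \<le> q m"
    and t: "0 \<le> t" and Re: "0 \<le> Re s" and s: "s \<noteq> of_real r"
  defines "\<rho> \<equiv> of_real r / (of_real r - s)"
  shows "(LINT x|mixed_erlang_law M q r. exp (- s * of_real (max 0 (t - x))))
      = (\<Sum>m=1..M. of_real (q m) * (\<rho> ^ m * exp (- s * of_real t)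
          + (\<Sum>l=0..m-1. (of_real (r * t)) ^ l / fact l * exp (- of_real (r * t)) * (1 - \<rho> ^ (m - l)))))"
proof -
  let ?e = "\<lambda>x. exp (- s * of_real (max 0 (t - x)))"
  have "(LINT x|mixed_erlang_law M q r. ?e x)
      = (LINT x|lborel. (\<Sum>m=1..M. q m * erlang_density (m - 1) r x) *\<^sub>R ?e x)"
    unfolding mixed_erlang_law_def
    using r q by (intro integral_density) (auto intro!: AE_I2 sum_nonneg)
  also have "\<dots> = (LINT x|lborel. (\<Sum>m=1..M. of_real (q m) * (of_real (erlang_density (m - 1) r x) * ?e x)))"
    by (simp add: scaleR_conv_of_real sum_distrib_right mult.assoc)
  also have "\<dots> = (\<Sum>m=1..M. of_real (q m) * (LINT x|lborel. of_real (erlang_density (m - 1) r x) * ?e x))"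
    using erlang_reflected_exp(2)[OF r t Re s] by (subst Bochner_Integration.integral_sum) auto
  also have "\<dots> = (\<Sum>m=1..M. of_real (q m) * (\<rho> ^ m * exp (- s * of_real t)
          + (\<Sum>l=0..m-1. (of_real (r * t)) ^ l / fact l * exp (- of_real (r * t)) * (1 - \<rho> ^ (m - l)))))"
    unfolding erlang_reflected_exp(1)[OF r t Re s] \<rho>_def[symmetric]
    by (intro sum.cong refl) (simp add: atMost_atLeast0)
  finally show ?thesis .
qed

section \<open>Unnormalised laws and independence\<close>

text \<open>The law of \<open>X\<close> on the event \<open>E\<close>, without normalisation. Conditional laws would force a separate
treatment of states that the chain occupies with probability 0; here they just give the zero measure.\<close>

definition event_law :: "'w measure \<Rightarrow> 'w set \<Rightarrow> 'x measure \<Rightarrow> ('w \<Rightarrow> 'x) \<Rightarrow> 'x measure" where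
  "event_law M E N X = distr (density M (indicator E)) N X"

lemma sets_event_law [simp, measurable_cong]: "sets (event_law M E N X) = sets N"
  by (simp add: event_law_def)

lemma space_event_law [simp]: "space (event_law M E N X) = space N"
  by (simp add: event_law_def)

lemma emeasure_event_law:
  assumes "E \<in> sets M" "X \<in> measurable M N" "B \<in> sets N"
  shows "emeasure (event_law M E N X) B = emeasure M {\<omega>\<in>E. X \<omega> \<in> B}"
proof -
  have "E \<inter> (X -` B \<inter> space M) = {\<omega>\<in>E. X \<omega> \<in> B}"
    using sets.sets_into_space[OF assms(1)] by auto
  with assms show ?thesis
    by (simp add: event_law_def emeasure_distr emeasure_restricted)
qed

lemma finite_measure_event_law:
  assumes "finite_measure M" "E \<in> sets M" "X \<in> measurable M N"
  shows "finite_measure (event_law M E N X)"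
  unfolding event_law_def
  using assms by (intro finite_measure.finite_measure_distr finite_measure.finite_measure_restricted) auto

lemma integral_event_law:
  fixes f :: "'x \<Rightarrow> complex"
  assumes [measurable]: "E \<in> sets M" "X \<in> measurable M N" "f \<in> borel_measurable N"
  shows "integral\<^sup>L (event_law M E N X) f = (LINT \<omega>|M. indicator E \<omega> *\<^sub>R f (X \<omega>))"
proof -
  have "density M (indicator E) = density M (\<lambda>\<omega>. ennreal (indicator E \<omega>))"
    by (intro arg_cong[where f="density M"]) (auto simp: indicator_def)
  then show ?thesis
    by (simp add: event_law_def integral_distr integral_density)
qed

lemma AE_event_law_nonneg:
  fixes X :: "'w \<Rightarrow> real"
  assumes [measurable]: "E \<in> sets M" "X \<in> borel_measurable M"
    and "\<And>\<omega>. \<omega> \<in> space M \<Longrightarrow> 0 \<le> X \<omega>"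
  shows "AE x in event_law M E borel X. 0 \<le> x"
proof -
  have "AE \<omega> in density M (indicator E). 0 \<le> X \<omega>"
    using assms(3) by (intro AE_I2) auto
  then show ?thesis
    unfolding event_law_def by (subst AE_distr_iff) auto
qed

text \<open>Boxes with an arbitrary Borel first side are used because the hypotheses speak of the past through
arbitrary events, but of service and interarrival times only through their distribution functions.\<close>

lemma measure_eqI_boxes:
  fixes K L :: "((real \<times> real) \<times> real) measure"
  assumes "finite_measure K"
    and sets: "sets K = sets ((borel \<Otimes>\<^sub>M borel) \<Otimes>\<^sub>M borel)" "sets L = sets ((borel \<Otimes>\<^sub>M borel) \<Otimes>\<^sub>M borel)"
    and eq: "\<And>B x y. B \<in> sets borel \<Longrightarrow>
      emeasure K ((B \<times> {..y}) \<times> {..x}) = emeasure L ((B \<times> {..y}) \<times> {..x})"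
  shows "K = L"
proof -
  define E1 where "E1 = {B \<times> C |B C. B \<in> sets (borel :: real measure) \<and> C \<in> range (atMost :: real \<Rightarrow> real set)}"
  define E2 where "E2 = {B \<times> C |B C. B \<in> E1 \<and> C \<in> range (atMost :: real \<Rightarrow> real set)}"
  have E1I: "B \<times> {..y} \<in> E1" if "B \<in> sets borel" for B y
    using that unfolding E1_def by blast
  have E2I: "C \<times> {..x} \<in> E2" if "C \<in> E1" for C x
    using that unfolding E2_def by blast
  have borel: "sets (borel :: real measure) = sigma_sets UNIV (range atMost)"
    by (subst borel_eq_atMost) simp
  have cover: "(\<Union>n::nat. {..real n}) = UNIV"
    by (auto intro: real_arch_simple)
  have "sets ((borel :: real measure) \<Otimes>\<^sub>M (borel :: real measure)) = sets (sigma (space borel \<times> space borel) E1)"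
    unfolding E1_def
    by (rule sets_pair_eq[where Ca="{UNIV}" and Cb="range (\<lambda>n::nat. {..real n})"])
      (use borel cover in \<open>auto simp: sigma_sets_sigma_sets_eq\<close>)
  then have sets1: "sets ((borel :: real measure) \<Otimes>\<^sub>M (borel :: real measure)) = sigma_sets UNIV E1"
    by simp
  have "sets (((borel :: real measure) \<Otimes>\<^sub>M (borel :: real measure)) \<Otimes>\<^sub>M (borel :: real measure))
      = sets (sigma (space (borel \<Otimes>\<^sub>M borel) \<times> space borel) E2)"
    unfolding E2_def
  proof (rule sets_pair_eq[where Ca="range (\<lambda>n::nat. UNIV \<times> {..real n})" and Cb="range (\<lambda>n::nat. {..real n})"])
    show "range (\<lambda>n. UNIV \<times> {..real n}) \<subseteq> E1" using E1I[of UNIV] by auto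
    show "\<Union> (range (\<lambda>n. UNIV \<times> {..real n})) = space (borel \<Otimes>\<^sub>M borel)"
      using cover by (auto simp: space_pair_measure)
  qed (use borel cover sets1 in \<open>auto simp: space_pair_measure\<close>)
  then have sets2: "sets (((borel :: real measure) \<Otimes>\<^sub>M (borel :: real measure)) \<Otimes>\<^sub>M (borel :: real measure)) = sigma_sets UNIV E2"
    by (simp add: space_pair_measure)
  show ?thesis
  proof (rule measure_eqI_generator_eq[where E=E2 and \<Omega>=UNIV and A="\<lambda>n. (UNIV \<times> {..real n}) \<times> {..real n}"])
    show "Int_stable E2"
    proof (rule Int_stableI)
      fix U V assume "U \<in> E2" "V \<in> E2"
      then obtain B C x y x' y' where [measurable]: "B \<in> sets borel" "C \<in> sets borel"
        and UV: "U = (B \<times> {..y}) \<times> {..x}" "V = (C \<times> {..y'}) \<times> {..x'}"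
        by (auto simp: E1_def E2_def)
      have "U \<inter> V = ((B \<inter> C) \<times> {..min y y'}) \<times> {..min x x'}"
        unfolding UV by auto
      moreover have "B \<inter> C \<in> sets borel" by simp
      ultimately show "U \<inter> V \<in> E2" using E2I E1I by simp
    qed
    show "emeasure K U = emeasure L U" if "U \<in> E2" for U
      using that eq by (auto simp: E1_def E2_def)
    show "range (\<lambda>n. (UNIV \<times> {..real n}) \<times> {..real n}) \<subseteq> E2"
      using E2I[OF E1I[of UNIV]] by auto
    show "(\<Union>n. (UNIV \<times> {..real n}) \<times> {..real n}) = (UNIV :: ((real \<times> real) \<times> real) set)"
    proof -
      have "((w, y), x) \<in> (\<Union>n. (UNIV \<times> {..real n}) \<times> {..real n})" for w x y :: real
      proof -
        obtain n :: nat where "max x y \<le> real n" using real_arch_simple by blast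
        then show ?thesis by (intro UN_I[of n]) auto
      qed
      then show ?thesis by (metis (no_types, lifting) UNIV_eq_I surj_pair)
    qed
    show "emeasure K ((UNIV \<times> {..real n}) \<times> {..real n}) \<noteq> \<infinity>" for n
      using finite_measure.emeasure_finite[OF assms(1)] by simp
  qed (use sets sets2 in auto)
qed

lemma laplace_convolution:
  fixes \<mu> \<nu> :: "real measure"
  assumes fin: "finite_measure \<mu>" "finite_measure \<nu>"
    and [measurable_cong]: "sets \<mu> = sets borel" "sets \<nu> = sets borel"
    and nn: "AE w in \<mu>. 0 \<le> w" "AE y in \<nu>. 0 \<le> y"
    and a: "0 \<le> a"
  shows "finite_measure (\<mu> \<Otimes>\<^sub>M \<nu>)"
    and "(\<lambda>(w, y). a * w + y) \<in> borel_measurable (\<mu> \<Otimes>\<^sub>M \<nu>)"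
    and "AE z in \<mu> \<Otimes>\<^sub>M \<nu>. 0 \<le> (case z of (w, y) \<Rightarrow> a * w + y)"
    and "0 \<le> Re s \<Longrightarrow> laplace (\<mu> \<Otimes>\<^sub>M \<nu>) (\<lambda>(w, y). a * w + y) s
          = laplace \<mu> (\<lambda>w. w) (of_real a * s) * laplace \<nu> (\<lambda>y. y) s"
proof -
  interpret M: finite_measure \<mu> by fact
  interpret N: finite_measure \<nu> by fact
  interpret P: pair_sigma_finite \<mu> \<nu> ..
  show finP: "finite_measure (\<mu> \<Otimes>\<^sub>M \<nu>)"
    using fin by (intro finite_measure_pair_measure)
  show meas [measurable]: "(\<lambda>(w, y). a * w + y) \<in> borel_measurable (\<mu> \<Otimes>\<^sub>M \<nu>)"
    by measurable
  show ae: "AE z in \<mu> \<Otimes>\<^sub>M \<nu>. 0 \<le> (case z of (w, y) \<Rightarrow> a * w + y)"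
  proof (rule P.AE_pair_measure)
    show "AE w in \<mu>. AE y in \<nu>. 0 \<le> (case (w, y) of (w, y) \<Rightarrow> a * w + y)"
      using nn(1) by eventually_elim (use nn(2) a in \<open>auto elim!: eventually_mono\<close>)
  qed measurable
  assume s: "0 \<le> Re s"
  have int: "integrable (\<mu> \<Otimes>\<^sub>M \<nu>) (\<lambda>z. exp (- s * complex_of_real (case z of (w, y) \<Rightarrow> a * w + y)))"
    by (rule integrable_exp_laplace[OF finP meas ae s])
  have "laplace (\<mu> \<Otimes>\<^sub>M \<nu>) (\<lambda>(w, y). a * w + y) s
      = (LINT w|\<mu>. LINT y|\<nu>. exp (- s * complex_of_real (a * w + y)))"
    unfolding laplace_def by (subst P.integral_fst'[OF int, symmetric]) simp
  also have "\<dots> = (LINT w|\<mu>. exp (- (of_real a * s) * of_real w) * laplace \<nu> (\<lambda>y. y) s)"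
  proof -
    have "exp (- s * complex_of_real (a * w + y)) = exp (- (of_real a * s) * of_real w) * exp (- s * of_real y)" for w y
      by (simp add: exp_add[symmetric] algebra_simps)
    then show ?thesis
      unfolding laplace_def by (simp only: integral_mult_right_zero)
  qed
  also have "\<dots> = laplace \<mu> (\<lambda>w. w) (of_real a * s) * laplace \<nu> (\<lambda>y. y) s"
    unfolding laplace_def by simp
  finally show "laplace (\<mu> \<Otimes>\<^sub>M \<nu>) (\<lambda>(w, y). a * w + y) s
          = laplace \<mu> (\<lambda>w. w) (of_real a * s) * laplace \<nu> (\<lambda>y. y) s" .
qed

text \<open>Integrate the Erlang formula over \<open>T\<close>. The terms \<open>T ^ l exp (- r T)\<close> are, up to the sign
\<open>(- 1) ^ l\<close>, what the \<open>l\<close>th derivative of the transform of \<open>T\<close> at \<open>r\<close> averages; this is how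
derivatives enter the workload equation.\<close>

lemma mixed_erlang_reflected_laplace:
  fixes T :: "'x \<Rightarrow> real" and s :: complex
  assumes fin: "finite_measure R" and [measurable]: "T \<in> borel_measurable R"
    and nn: "AE z in R. 0 \<le> T z"
    and r: "0 < r" and q: "\<And>m. m \<in> {1..M} \<Longrightarrow> 0 \<le> q m" "(\<Sum>m=1..M. q m) = 1"
    and Re: "0 \<le> Re s" and s: "s \<noteq> of_real r"
  defines "\<rho> \<equiv> of_real r / (of_real r - s)"
  shows "laplace (R \<Otimes>\<^sub>M mixed_erlang_law M q r) (\<lambda>(z, x). max 0 (T z - x)) s
      = (\<Sum>m=1..M. of_real (q m) * (\<rho> ^ m * laplace R T s
          + (\<Sum>l=0..m-1. (- of_real r) ^ l / fact l * (deriv ^^ l) (laplace R T) (of_real r) * (1 - \<rho> ^ (m - l)))))"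
proof -
  let ?G = "mixed_erlang_law M q r"
  interpret R: finite_measure R by fact
  interpret G: prob_space ?G by (rule prob_space_mixed_erlang_law[OF r q])
  interpret P: pair_sigma_finite R ?G ..
  have finP: "finite_measure (R \<Otimes>\<^sub>M ?G)"
    by (intro finite_measure_pair_measure fin G.finite_measure_axioms)
  have int: "integrable (R \<Otimes>\<^sub>M ?G) (\<lambda>z. exp (- s * complex_of_real (case z of (z, x) \<Rightarrow> max 0 (T z - x))))"
    by (rule integrable_exp_laplace[OF finP _ _ Re]) auto
  \<comment> \<open>The closed form of the inner integral is a linear combination of these two kinds of functions of T.\<close>
  define c where "c m l = of_real r ^ l / fact l * (1 - \<rho> ^ (m - l))" for m l
  have minus_one_power: "(- 1) ^ l * (- x) ^ l = x ^ l" for x :: complex and l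
    by (simp only: power_mult_distrib[symmetric]) simp
  define h where "h l z = of_real (T z) ^ l * exp (- of_real r * complex_of_real (T z))" for l z
  have h: "h l = (\<lambda>z. (- 1) ^ l * ((- of_real (T z)) ^ l * exp (- of_real r * of_real (T z))))" for l
    unfolding h_def mult.assoc[symmetric] minus_one_power by simp
  have int_h: "integrable R (h l)" for l
    unfolding h by (intro integrable_mult_right laplace_power_series(2)[OF fin _ nn, of 0]) (use r in auto)
  have integral_h: "integral\<^sup>L R (h l) = (- 1) ^ l * (deriv ^^ l) (laplace R T) (of_real r)" for l
    unfolding h by (subst higher_deriv_laplace[OF fin _ nn r]) auto
  have int_e: "integrable R (\<lambda>z. exp (- s * of_real (T z)))"
    by (rule integrable_exp_laplace[OF fin _ nn Re]) auto
  have "laplace (R \<Otimes>\<^sub>M ?G) (\<lambda>(z, x). max 0 (T z - x)) s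
      = (LINT z|R. LINT x|?G. exp (- s * complex_of_real (max 0 (T z - x))))"
    unfolding laplace_def by (subst P.integral_fst'[OF int, symmetric]) simp
  also have "\<dots> = (LINT z|R. (\<Sum>m=1..M. of_real (q m) * (\<rho> ^ m * exp (- s * of_real (T z)) + (\<Sum>l=0..m-1. c m l * h l z))))"
  proof (rule integral_cong_AE)
    show "AE z in R. (LINT x|?G. exp (- s * complex_of_real (max 0 (T z - x))))
        = (\<Sum>m=1..M. of_real (q m) * (\<rho> ^ m * exp (- s * of_real (T z)) + (\<Sum>l=0..m-1. c m l * h l z)))"
      using nn
    proof eventually_elim
      case (elim z)
      show ?case
        unfolding c_def h_def
        by (subst mixed_erlang_reflected_exp[OF r _ elim Re s])
          (use q(1) in \<open>auto simp: \<rho>_def[symmetric] power_mult_distrib mult_ac\<close>)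
    qed
    show "(\<lambda>z. LINT x|?G. exp (- s * complex_of_real (max 0 (T z - x)))) \<in> borel_measurable R"
      by measurable
    show "(\<lambda>z. \<Sum>m=1..M. of_real (q m) * (\<rho> ^ m * exp (- s * of_real (T z)) + (\<Sum>l=0..m-1. c m l * h l z))) \<in> borel_measurable R"
      unfolding h_def by measurable
  qed
  also have "\<dots> = (\<Sum>m=1..M. of_real (q m) * (\<rho> ^ m * laplace R T s + (\<Sum>l=0..m-1. c m l * integral\<^sup>L R (h l))))"
    unfolding laplace_def
    by (subst Bochner_Integration.integral_sum, use int_h int_e in simp, rule sum.cong[OF refl],
        subst integral_mult_right_zero, subst Bochner_Integration.integral_add,
        use int_h int_e in simp, use int_h int_e in simp, subst Bochner_Integration.integral_sum,
        use int_h int_e in simp, simp)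
  also have "\<dots> = (\<Sum>m=1..M. of_real (q m) * (\<rho> ^ m * laplace R T s
          + (\<Sum>l=0..m-1. (- of_real r) ^ l / fact l * (deriv ^^ l) (laplace R T) (of_real r) * (1 - \<rho> ^ (m - l)))))"
  proof -
    have "c m l * ((- 1) ^ l * D) = (- of_real r) ^ l / fact l * D * (1 - \<rho> ^ (m - l))" for m l D
    proof -
      have "c m l * ((- 1) ^ l * D) = ((- 1) ^ l * of_real r ^ l) / fact l * D * (1 - \<rho> ^ (m - l))"
        unfolding c_def by (simp only: mult_ac times_divide_eq_left times_divide_eq_right)
      also have "(- 1) ^ l * of_real r ^ l = (- complex_of_real r) ^ l"
        using minus_one_power[of l "- complex_of_real r"] by simp
      finally show ?thesis .
    qed
    then show ?thesis unfolding integral_h by simp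
  qed
  finally show ?thesis .
qed

section \<open>Joint law of workload, service and interarrival time\<close>

context modulated_workload begin

definition state_event :: "nat \<Rightarrow> nat \<Rightarrow> 'w set" where
  "state_event n i = {\<omega>\<in>space \<Omega>. Y n \<omega> = i}"

definition jump_event :: "nat \<Rightarrow> nat \<Rightarrow> nat \<Rightarrow> 'w set" where
  "jump_event n i j = {\<omega>\<in>space \<Omega>. Y n \<omega> = i \<and> Y (Suc n) \<omega> = j}"

lemma state_event_sets [measurable]: "state_event n i \<in> sets \<Omega>"
  unfolding state_event_def using Y_measurable[of n] by measurable

lemma jump_event_sets [measurable]: "jump_event n i j \<in> sets \<Omega>"
  unfolding jump_event_def using Y_measurable[of n] Y_measurable[of "Suc n"] by measurable

lemmas variables_measurable [measurable] = W_measurable S_measurable A_measurable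

text \<open>A distribution function that vanishes on the negative half-line has its measure concentrated on the closed
half-line, so the restriction of the domain in the Laplace-Stieltjes transform has no effect.\<close>

lemma service_law:
  assumes i: "i \<in> {1..N}"
  shows "prob_space (interval_measure (F i))"
    and "emeasure (interval_measure (F i)) {..y} = ennreal (F i y)"
    and "AE y in interval_measure (F i). 0 \<le> y"
    and "0 \<le> F i y"
    and "laplace_stieltjes (F i) s = laplace (interval_measure (F i)) (\<lambda>y. y) s"
proof -
  have df: "\<And>x y. x \<le> y \<Longrightarrow> F i x \<le> F i y" "\<And>x. continuous (at_right x) (F i)"
    "(F i \<longlongrightarrow> 1) at_top" and neg: "\<And>x. x < 0 \<Longrightarrow> F i x = 0"
    using F[OF i] by (auto simp: distribution_function_nonneg_def mono_def)
  have bot: "(F i \<longlongrightarrow> 0) at_bot"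
    by (rule tendsto_eventually) (auto simp: eventually_at_bot_dense neg intro!: exI[of _ 0])
  interpret D: real_distribution "interval_measure (F i)"
    by (rule real_distribution_interval_measure[OF df(1,2) bot df(3)])
  show "prob_space (interval_measure (F i))" by (rule D.prob_space_axioms)
  show "emeasure (interval_measure (F i)) {..y} = ennreal (F i y)" for y
    by (rule emeasure_interval_measure_Iic[OF df(1,2) bot])
  have meas: "measure (interval_measure (F i)) {..y} = F i y" for y
    by (rule measure_interval_measure_Iic[OF df(1,2) bot])
  show "0 \<le> F i y" using meas[of y] by (metis measure_nonneg)
  have "emeasure (interval_measure (F i)) {..<0} = 0"
  proof -
    \<comment> \<open>The open half-line is exhausted by closed half-lines, on which F i gives the mass directly; a possible
      atom at 0 stays outside.\<close>
    have "emeasure (interval_measure (F i)) (\<Union>k::nat. {..- 1 / real (Suc k)}) = 0"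
      by (rule emeasure_UN_eq_0)
        (auto simp: emeasure_interval_measure_Iic[OF df(1,2) bot] neg)
    also have "(\<Union>k::nat. {..- 1 / real (Suc k)}) = {..<0}"
    proof safe
      fix x :: real assume "x < 0"
      then obtain k where "inverse (real (Suc k)) < - x" using reals_Archimedean[of "- x"] by auto
      then show "x \<in> (\<Union>k::nat. {..- 1 / real (Suc k)})" by (auto simp: field_simps intro!: exI[of _ k])
    next
      fix x k assume "x \<le> - 1 / real (Suc k)"
      also have "\<dots> < 0" by simp
      finally show "x < 0" .
    qed
    finally show ?thesis .
  qed
  then show ae: "AE y in interval_measure (F i). 0 \<le> y"
    by (intro AE_I[where N="{..<0}"]) auto
  show "laplace_stieltjes (F i) s = laplace (interval_measure (F i)) (\<lambda>y. y) s" for s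
    unfolding laplace_stieltjes_def laplace_def set_lebesgue_integral_def
    by (rule integral_cong_AE) (use ae in \<open>auto elim!: eventually_mono\<close>)
qed

text \<open>Conditional independence separates the workload from service time, interarrival time and next state; the
joint law then evaluates the rest. For a negative \<open>x\<close> or \<open>y\<close>, where the joint law says nothing, both
sides vanish.\<close>

lemma jump_box_prob:
  assumes ij: "i \<in> {1..N}" "j \<in> {1..N}" and B [measurable]: "B \<in> sets borel"
  shows "prob {\<omega>\<in>space \<Omega>. Y n \<omega> = i \<and> Y (Suc n) \<omega> = j \<and> W n \<omega> \<in> B \<and> S n \<omega> \<le> y \<and> A (Suc n) \<omega> \<le> x}
    = p i j * prob {\<omega>\<in>space \<Omega>. Y n \<omega> = i \<and> W n \<omega> \<in> B} * F i y * measure (mixed_erlang_law M q (rate j)) {..x}"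
    (is "prob ?box = p i j * prob ?H * _ * _")
proof (cases "0 \<le> x \<and> 0 \<le> y")
  case False
  have "?box = {}"
    using False S_nonneg[of _ n] A_nonneg[of _ n] by force
  then have "prob ?box = 0" by (simp only: measure_empty)
  moreover have "F i y * measure (mixed_erlang_law M q (rate j)) {..x} = 0"
  proof (cases "x < 0")
    case True
    then have "measure (mixed_erlang_law M q (rate j)) {..x} = 0"
      by (subst measure_mixed_erlang_law_atMost) (use rate ij q in auto)
    then show ?thesis by simp
  next
    case x: False
    then show ?thesis using False F[OF ij(1)] by (auto simp: distribution_function_nonneg_def)
  qed
  ultimately show ?thesis by simp
next
  case True
  have G: "measure (mixed_erlang_law M q (rate j)) {..x} = mixed_erlang M q (rate j) x"
    using True by (subst measure_mixed_erlang_law_atMost) (use rate ij q in auto)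
  define c where "c = prob (state_event n i)"
  have Hle: "prob ?H \<le> c" unfolding c_def
    by (intro finite_measure_mono state_event_sets) (auto simp: state_event_def)
  have boxle: "prob ?box \<le> prob ?H"
    using Y_measurable[of n] by (intro finite_measure_mono) auto
  show ?thesis
  proof (cases "c = 0")
    case True
    with Hle boxle show ?thesis by (simp add: measure_le_0_iff)
  next
    case False
    then have c: "0 < \<P>(\<omega> in \<Omega>. Y n \<omega> = i)"
      using measure_nonneg[of \<Omega>] by (simp add: c_def state_event_def zero_less_measure_iff)
    define C where "C = {..x} \<times> {..y} \<times> {j}"
    define H where "H = W n -` B \<inter> space \<Omega>"
    have C: "C \<in> sets (borel \<Otimes>\<^sub>M borel \<Otimes>\<^sub>M count_space UNIV)"
      unfolding C_def by measurable
    have H: "H \<in> sets (past \<Omega> Y W S A n)"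
    proof -
      have Hin: "H \<in> {W k -` B \<inter> space \<Omega> | k B. k \<le> n \<and> B \<in> sets borel}"
        unfolding H_def using B by blast
      show ?thesis
        unfolding past_def by (rule in_measure_of[OF _ UnI1[OF UnI1[OF UnI2[OF Hin]]]]) blast
    qed
    have box: "\<P>(\<omega> in \<Omega>. (A (Suc n) \<omega>, S n \<omega>, Y (Suc n) \<omega>) \<in> C \<and> \<omega> \<in> H \<bar> Y n \<omega> = i) = prob ?box / c"
      unfolding cond_prob_def c_def state_event_def C_def H_def
      by (intro arg_cong2[where f="(/)"] arg_cong[where f=prob] refl) auto
    have history: "\<P>(\<omega> in \<Omega>. \<omega> \<in> H \<bar> Y n \<omega> = i) = prob ?H / c"
      unfolding cond_prob_def c_def state_event_def H_def
      by (intro arg_cong2[where f="(/)"] arg_cong[where f=prob] refl) auto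
    have step: "\<P>(\<omega> in \<Omega>. (A (Suc n) \<omega>, S n \<omega>, Y (Suc n) \<omega>) \<in> C \<bar> Y n \<omega> = i)
        = \<P>(\<omega> in \<Omega>. A (Suc n) \<omega> \<le> x \<and> S n \<omega> \<le> y \<and> Y (Suc n) \<omega> = j \<bar> Y n \<omega> = i)"
      by (simp add: C_def)
    have "prob ?box / c = p i j * F i y * mixed_erlang M q (rate j) x * (prob ?H / c)"
      unfolding box[symmetric] history[symmetric] cond_indep[OF ij(1) C H c] step
      using \<open>0 \<le> x \<and> 0 \<le> y\<close> by (subst joint_law[OF ij _ _ c]) auto
    then have "prob ?box = p i j * F i y * mixed_erlang M q (rate j) x * prob ?H"
      using False by (simp only: times_divide_eq_right divide_cancel_right) simp
    then show ?thesis unfolding G by (simp only: mult_ac)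
  qed
qed

definition workload_law :: "nat \<Rightarrow> nat \<Rightarrow> real measure" where
  "workload_law n i = event_law \<Omega> (state_event n i) borel (W n)"

lemma sets_workload_law [simp, measurable_cong]: "sets (workload_law n i) = sets borel"
  by (simp add: workload_law_def)

lemma finite_workload_law: "finite_measure (workload_law n i)"
  unfolding workload_law_def by (intro finite_measure_event_law finite_measure_axioms) measurable

text \<open>On a given transition, workload, service time and interarrival time are independent, and the interarrival
law depends on the target state only.\<close>

lemma jump_law:
  assumes ij: "i \<in> {1..N}" "j \<in> {1..N}"
  shows "event_law \<Omega> (jump_event n i j) ((borel \<Otimes>\<^sub>M borel) \<Otimes>\<^sub>M borel) (\<lambda>\<omega>. ((W n \<omega>, S n \<omega>), A (Suc n) \<omega>))
    = density ((workload_law n i \<Otimes>\<^sub>M interval_measure (F i)) \<Otimes>\<^sub>M mixed_erlang_law M q (rate j))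
        (\<lambda>_. ennreal (p i j))"
    (is "?K = density ((?\<mu> \<Otimes>\<^sub>M ?\<nu>) \<Otimes>\<^sub>M ?G) _")
proof (rule measure_eqI_boxes)
  have triple_meas: "(\<lambda>\<omega>. ((W n \<omega>, S n \<omega>), A (Suc n) \<omega>)) \<in> measurable \<Omega> ((borel \<Otimes>\<^sub>M borel) \<Otimes>\<^sub>M borel)"
    by measurable
  interpret \<mu>: finite_measure ?\<mu> by (rule finite_workload_law)
  interpret \<nu>: prob_space ?\<nu> by (rule service_law(1)[OF ij(1)])
  interpret G: prob_space ?G by (rule prob_space_mixed_erlang_law[OF rate[OF ij(2)] q])
  have p: "0 \<le> p i j" using stochastic ij by (auto simp: stochastic_on_def)
  show "finite_measure ?K"
    by (intro finite_measure_event_law finite_measure_axioms triple_meas) measurable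
  show "sets ?K = sets ((borel \<Otimes>\<^sub>M borel) \<Otimes>\<^sub>M borel)" by simp
  show "sets (density ((?\<mu> \<Otimes>\<^sub>M ?\<nu>) \<Otimes>\<^sub>M ?G) (\<lambda>_. ennreal (p i j))) = sets ((borel \<Otimes>\<^sub>M borel) \<Otimes>\<^sub>M borel)"
    by (simp cong: sets_pair_measure_cong)
  fix B :: "real set" and x y :: real assume B [measurable]: "B \<in> sets borel"
  have \<mu>B: "emeasure ?\<mu> B = ennreal (prob {\<omega>\<in>space \<Omega>. Y n \<omega> = i \<and> W n \<omega> \<in> B})"
    unfolding workload_law_def emeasure_event_law[OF state_event_sets W_measurable B]
    by (auto simp: state_event_def emeasure_eq_measure intro!: arg_cong[where f=prob])
  have "emeasure ?K ((B \<times> {..y}) \<times> {..x})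
      = emeasure \<Omega> {\<omega>\<in>jump_event n i j. ((W n \<omega>, S n \<omega>), A (Suc n) \<omega>) \<in> (B \<times> {..y}) \<times> {..x}}"
    by (rule emeasure_event_law[OF _ triple_meas]) measurable
  also have "\<dots> = ennreal (prob {\<omega>\<in>space \<Omega>. Y n \<omega> = i \<and> Y (Suc n) \<omega> = j \<and> W n \<omega> \<in> B \<and> S n \<omega> \<le> y \<and> A (Suc n) \<omega> \<le> x})"
    unfolding emeasure_eq_measure jump_event_def
    by (intro arg_cong[where f=ennreal] arg_cong[where f=prob]) auto
  also have "\<dots> = ennreal (p i j) * (ennreal (prob {\<omega>\<in>space \<Omega>. Y n \<omega> = i \<and> W n \<omega> \<in> B}) * ennreal (F i y) * ennreal (measure ?G {..x}))"
    unfolding jump_box_prob[OF ij B] using p service_law(4)[OF ij(1)]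
    by (simp add: ennreal_mult mult.assoc)
  also have "\<dots> = ennreal (p i j) * emeasure ((?\<mu> \<Otimes>\<^sub>M ?\<nu>) \<Otimes>\<^sub>M ?G) ((B \<times> {..y}) \<times> {..x})"
    by (subst G.emeasure_pair_measure_Times, measurable, subst \<nu>.emeasure_pair_measure_Times)
      (auto simp: \<mu>B service_law(2)[OF ij(1)] G.emeasure_eq_measure)
  also have "\<dots> = emeasure (density ((?\<mu> \<Otimes>\<^sub>M ?\<nu>) \<Otimes>\<^sub>M ?G) (\<lambda>_. ennreal (p i j))) ((B \<times> {..y}) \<times> {..x})"
    by (subst emeasure_density_const) measurable
  finally show "emeasure ?K ((B \<times> {..y}) \<times> {..x})
      = emeasure (density ((?\<mu> \<Otimes>\<^sub>M ?\<nu>) \<Otimes>\<^sub>M ?G) (\<lambda>_. ennreal (p i j))) ((B \<times> {..y}) \<times> {..x})" .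
qed

section \<open>The transform equation at a finite time\<close>

lemma joint_transform_eq_laplace:
  "joint_transform \<Omega> (W n) (Y n) i s = laplace (workload_law n i) (\<lambda>w. w) s"
proof -
  have "laplace (workload_law n i) (\<lambda>w. w) s
      = (LINT \<omega>|\<Omega>. indicator (state_event n i) \<omega> *\<^sub>R exp (- s * complex_of_real (W n \<omega>)))"
    unfolding laplace_def workload_law_def by (rule integral_event_law) measurable
  also have "\<dots> = joint_transform \<Omega> (W n) (Y n) i s"
    unfolding joint_transform_def
    by (intro Bochner_Integration.integral_cong) (auto simp: state_event_def indicator_def)
  finally show ?thesis ..
qed

lemma workload_law_nonneg: "AE w in workload_law n i. 0 \<le> w"
  unfolding workload_law_def by (rule AE_event_law_nonneg) (auto intro: W_nonneg)

lemma scaled_transform_eq_laplace: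
  "joint_transform \<Omega> (W n) (Y n) i (of_real a * u) = laplace (workload_law n i) (\<lambda>w. a * w) u"
  unfolding joint_transform_eq_laplace by (simp add: laplace_def mult_ac)

lemma scaled_transform_holomorphic:
  "(\<lambda>u. joint_transform \<Omega> (W n) (Y n) i (of_real a * u)) holomorphic_on ball (of_real r) r"
  unfolding scaled_transform_eq_laplace
  using a by (intro laplace_holomorphic finite_workload_law)
    (auto intro: eventually_mono[OF workload_law_nonneg])

lemma service_transform_holomorphic:
  assumes "i \<in> {1..N}"
  shows "laplace_stieltjes (F i) holomorphic_on ball (of_real r) r"
proof -
  interpret D: prob_space "interval_measure (F i)" by (rule service_law(1)[OF assms])
  have "laplace (interval_measure (F i)) (\<lambda>y. y) holomorphic_on ball (of_real r) r"
    by (intro laplace_holomorphic D.finite_measure_axioms service_law(3)[OF assms]) auto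
  then show ?thesis
    by (rule holomorphic_transform) (simp add: service_law(5)[OF assms])
qed

lemma norm_joint_transform_le:
  assumes "0 \<le> Re s"
  shows "norm (joint_transform \<Omega> (W n) (Y n) i s) \<le> 1"
proof -
  have "norm (joint_transform \<Omega> (W n) (Y n) i s) \<le> measure (workload_law n i) (space (workload_law n i))"
    unfolding joint_transform_eq_laplace
    by (intro norm_laplace_le finite_workload_law workload_law_nonneg assms) auto
  also have "\<dots> = prob {\<omega>\<in>state_event n i. W n \<omega> \<in> UNIV}"
    unfolding measure_def workload_law_def
    by (subst emeasure_event_law) auto
  also have "\<dots> \<le> 1" by simp
  finally show ?thesis .
qed

lemma norm_service_transform_le:
  assumes i: "i \<in> {1..N}" and "0 \<le> Re s"
  shows "norm (laplace_stieltjes (F i) s) \<le> 1"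
proof -
  interpret D: prob_space "interval_measure (F i)" by (rule service_law(1)[OF i])
  have "norm (laplace_stieltjes (F i) s) \<le> measure (interval_measure (F i)) (space (interval_measure (F i)))"
    unfolding service_law(5)[OF i]
    by (intro norm_laplace_le D.finite_measure_axioms service_law(3)[OF i] assms(2)) auto
  then show ?thesis using D.prob_space by simp
qed

text \<open>The transform of \<open>a W + S\<close> on \<open>{Y = i}\<close> at time \<open>n\<close>, in product form.\<close>

definition content_transform :: "nat \<Rightarrow> nat \<Rightarrow> complex \<Rightarrow> complex" where
  "content_transform n i = (\<lambda>u. joint_transform \<Omega> (W n) (Y n) i (of_real a * u) * laplace_stieltjes (F i) u)"

text \<open>The contribution of one transition: the recursion turns the left-hand side into an Erlang average of a
reflected difference, with \<open>a W + S\<close> as the first term of the difference.\<close>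

lemma jump_transform:
  assumes ij: "i \<in> {1..N}" "j \<in> {1..N}" and Re: "0 \<le> Re s" and s: "s \<noteq> of_real (rate j)"
  defines "\<rho> \<equiv> of_real (rate j) / (of_real (rate j) - s)"
  shows "(LINT \<omega>|\<Omega>. indicator (jump_event n i j) \<omega> *\<^sub>R exp (- s * complex_of_real (W (Suc n) \<omega>)))
    = of_real (p i j) * (\<Sum>m=1..M. of_real (q m) * (\<rho> ^ m * content_transform n i s
        + (\<Sum>l=0..m-1. (- of_real (rate j)) ^ l / fact l
            * (deriv ^^ l) (content_transform n i) (of_real (rate j)) * (1 - \<rho> ^ (m - l)))))"
proof -
  let ?\<mu> = "workload_law n i" and ?\<nu> = "interval_measure (F i)" and ?G = "mixed_erlang_law M q (rate j)"
  let ?T = "\<lambda>(w, y). a * w + y"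
  let ?f = "\<lambda>z. exp (- s * complex_of_real (case z of (z, x) \<Rightarrow> max 0 (?T z - x)))"
  have p: "0 \<le> p i j" using stochastic ij by (auto simp: stochastic_on_def)
  interpret \<nu>: prob_space ?\<nu> by (rule service_law(1)[OF ij(1)])
  note R = laplace_convolution[OF finite_workload_law[of n i] \<nu>.finite_measure_axioms sets_workload_law
      sets_interval_measure workload_law_nonneg service_law(3)[OF ij(1)] less_imp_le[OF a(1)]]
  have R_eq: "laplace (?\<mu> \<Otimes>\<^sub>M ?\<nu>) ?T u = content_transform n i u" if "0 \<le> Re u" for u
    unfolding R(4)[OF that] content_transform_def joint_transform_eq_laplace service_law(5)[OF ij(1)] ..
  have deriv_eq: "(deriv ^^ l) (laplace (?\<mu> \<Otimes>\<^sub>M ?\<nu>) ?T) (of_real (rate j))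
      = (deriv ^^ l) (content_transform n i) (of_real (rate j))" for l
  proof (rule higher_deriv_transform_within_open)
    show "laplace (?\<mu> \<Otimes>\<^sub>M ?\<nu>) ?T holomorphic_on ball (of_real (rate j)) (rate j)"
      by (rule laplace_holomorphic[OF R(1-3)])
    show "content_transform n i holomorphic_on ball (of_real (rate j)) (rate j)"
      unfolding content_transform_def
      by (intro holomorphic_on_mult scaled_transform_holomorphic service_transform_holomorphic ij)
    show "laplace (?\<mu> \<Otimes>\<^sub>M ?\<nu>) ?T w = content_transform n i w" if "w \<in> ball (of_real (rate j)) (rate j)" for w
    proof (rule R_eq)
      have "\<bar>Re (of_real (rate j) - w)\<bar> < rate j"
        using that abs_Re_le_cmod[of "of_real (rate j) - w"] by (simp add: dist_norm)
      then show "0 \<le> Re w" by auto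
    qed
  qed (use rate[OF ij(2)] in auto)
  have "(LINT \<omega>|\<Omega>. indicator (jump_event n i j) \<omega> *\<^sub>R exp (- s * complex_of_real (W (Suc n) \<omega>)))
      = (LINT \<omega>|\<Omega>. indicator (jump_event n i j) \<omega> *\<^sub>R ?f ((W n \<omega>, S n \<omega>), A (Suc n) \<omega>))"
    by (intro Bochner_Integration.integral_cong refl) (simp add: recursion)
  also have "\<dots> = integral\<^sup>L (event_law \<Omega> (jump_event n i j) ((borel \<Otimes>\<^sub>M borel) \<Otimes>\<^sub>M borel)
      (\<lambda>\<omega>. ((W n \<omega>, S n \<omega>), A (Suc n) \<omega>))) ?f"
    by (rule integral_event_law[symmetric]) measurable
  also have "\<dots> = of_real (p i j) * integral\<^sup>L ((?\<mu> \<Otimes>\<^sub>M ?\<nu>) \<Otimes>\<^sub>M ?G) ?f"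
    unfolding jump_law[OF ij] using p
    by (subst integral_density) (auto simp: scaleR_conv_of_real)
  also have "integral\<^sup>L ((?\<mu> \<Otimes>\<^sub>M ?\<nu>) \<Otimes>\<^sub>M ?G) ?f
      = laplace ((?\<mu> \<Otimes>\<^sub>M ?\<nu>) \<Otimes>\<^sub>M ?G) (\<lambda>(z, x). max 0 (?T z - x)) s"
    by (simp add: laplace_def)
  also have "\<dots> = (\<Sum>m=1..M. of_real (q m) * (\<rho> ^ m * laplace (?\<mu> \<Otimes>\<^sub>M ?\<nu>) ?T s
          + (\<Sum>l=0..m-1. (- of_real (rate j)) ^ l / fact l
            * (deriv ^^ l) (laplace (?\<mu> \<Otimes>\<^sub>M ?\<nu>) ?T) (of_real (rate j)) * (1 - \<rho> ^ (m - l)))))"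
    unfolding \<rho>_def by (rule mixed_erlang_reflected_laplace[OF R(1-3) rate[OF ij(2)] q Re s])
  finally show ?thesis unfolding deriv_eq R_eq[OF Re] .
qed

lemma one_step_transform:
  assumes j: "j \<in> {1..N}" and Re: "0 \<le> Re s" and s: "s \<noteq> of_real (rate j)"
  defines "\<rho> \<equiv> of_real (rate j) / (of_real (rate j) - s)"
  shows "joint_transform \<Omega> (W (Suc n)) (Y (Suc n)) j s
    = (\<Sum>i=1..N. of_real (p i j) * (\<Sum>m=1..M. of_real (q m) * (\<rho> ^ m * content_transform n i s
        + (\<Sum>l=0..m-1. (- of_real (rate j)) ^ l / fact l
            * (deriv ^^ l) (content_transform n i) (of_real (rate j)) * (1 - \<rho> ^ (m - l))))))"
proof -
  let ?e = "\<lambda>\<omega>. exp (- s * complex_of_real (W (Suc n) \<omega>))"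
  have int: "integrable \<Omega> (\<lambda>\<omega>. indicator (jump_event n i j) \<omega> *\<^sub>R ?e \<omega>)" for i
    by (intro integrable_mult_indicator jump_event_sets integrable_exp_laplace finite_measure_axioms
        W_measurable AE_I2 W_nonneg Re)
  have "joint_transform \<Omega> (W (Suc n)) (Y (Suc n)) j s
      = (LINT \<omega>|\<Omega>. (\<Sum>i=1..N. indicator (jump_event n i j) \<omega> *\<^sub>R ?e \<omega>))"
    unfolding joint_transform_def
  proof (intro Bochner_Integration.integral_cong refl)
    fix \<omega> assume \<omega>: "\<omega> \<in> space \<Omega>"
    have "(\<Sum>i=1..N. indicator (jump_event n i j) \<omega> *\<^sub>R ?e \<omega>)
        = (\<Sum>i=1..N. if Y n \<omega> = i then ?e \<omega> * of_bool (Y (Suc n) \<omega> = j) else 0)"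
      using \<omega> by (intro sum.cong refl) (auto simp: jump_event_def)
    also have "\<dots> = ?e \<omega> * of_bool (Y (Suc n) \<omega> = j)"
      using Y_range[OF \<omega>, of n] by (simp add: sum.delta)
    finally show "?e \<omega> * of_bool (Y (Suc n) \<omega> = j) = (\<Sum>i=1..N. indicator (jump_event n i j) \<omega> *\<^sub>R ?e \<omega>)" ..
  qed
  also have "\<dots> = (\<Sum>i=1..N. LINT \<omega>|\<Omega>. indicator (jump_event n i j) \<omega> *\<^sub>R ?e \<omega>)"
    by (rule Bochner_Integration.integral_sum[OF int])
  also have "\<dots> = (\<Sum>i=1..N. of_real (p i j) * (\<Sum>m=1..M. of_real (q m) * (\<rho> ^ m * content_transform n i s
        + (\<Sum>l=0..m-1. (- of_real (rate j)) ^ l / fact l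
            * (deriv ^^ l) (content_transform n i) (of_real (rate j)) * (1 - \<rho> ^ (m - l))))))"
    unfolding \<rho>_def by (intro sum.cong refl jump_transform j Re s)
  finally show ?thesis .
qed

section \<open>Passage to the steady state\<close>

abbreviation Z :: "nat \<Rightarrow> complex \<Rightarrow> complex" where
  "Z \<equiv> limit_transform \<Omega> W Y"

lemma Z_eq:
  assumes "i \<in> {1..N}" "0 \<le> Re s"
  shows "Z i s = joint_transform \<Omega>' Winf Yinf i s"
    and "(\<lambda>n. joint_transform \<Omega> (W n) (Y n) i s) \<longlonglongrightarrow> Z i s"
  using steady_state[OF assms] limI[OF steady_state[OF assms]]
  by (simp_all add: limit_transform_def)

lemma Re_nonneg_of_ball: "w \<in> ball (complex_of_real r) r \<Longrightarrow> 0 \<le> Re w"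
  using abs_Re_le_cmod[of "of_real r - w"] by (simp add: dist_norm)

lemma scaled_Z_holomorphic:
  assumes i: "i \<in> {1..N}"
  shows "(\<lambda>u. Z i (of_real a * u)) holomorphic_on ball (of_real r) r"
proof -
  define E where "E = {\<omega>\<in>space \<Omega>'. Yinf \<omega> = i}"
  have [measurable]: "E \<in> sets \<Omega>'" "Winf \<in> borel_measurable \<Omega>'"
    unfolding E_def using Yinf_measurable Winf_measurable by measurable
  let ?\<mu> = "event_law \<Omega>' E borel Winf"
  have "laplace ?\<mu> (\<lambda>w. a * w) holomorphic_on ball (of_real r) r"
  proof (rule laplace_holomorphic)
    show "finite_measure ?\<mu>"
      by (intro finite_measure_event_law steady.finite_measure_axioms) measurable
    have "AE w in ?\<mu>. 0 \<le> w"
      by (rule AE_event_law_nonneg) (auto intro: Winf_nonneg)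
    then show "AE w in ?\<mu>. 0 \<le> a * w"
      using a by (auto elim: eventually_mono)
  qed simp
  then show ?thesis
  proof (rule holomorphic_transform)
    show "laplace ?\<mu> (\<lambda>w. a * w) u = Z i (of_real a * u)" if "u \<in> ball (of_real r) r" for u
    proof -
      have "laplace ?\<mu> (\<lambda>w. a * w) u
          = (LINT \<omega>|\<Omega>'. indicator E \<omega> *\<^sub>R exp (- u * complex_of_real (a * Winf \<omega>)))"
        unfolding laplace_def by (rule integral_event_law) measurable
      also have "\<dots> = joint_transform \<Omega>' Winf Yinf i (of_real a * u)"
        unfolding joint_transform_def
        by (intro Bochner_Integration.integral_cong) (auto simp: E_def indicator_def mult_ac)
      also have "\<dots> = Z i (of_real a * u)"
        using Re_nonneg_of_ball[OF that] a by (intro Z_eq(1)[symmetric] i) auto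
      finally show ?thesis .
    qed
  qed
qed

lemma content_transform_tendsto:
  assumes i: "i \<in> {1..N}" and s: "0 \<le> Re s"
  shows "(\<lambda>n. content_transform n i s) \<longlonglongrightarrow> Z i (of_real a * s) * laplace_stieltjes (F i) s"
  unfolding content_transform_def
  using a s by (intro tendsto_intros Z_eq(2) i) auto

text \<open>Steady state is given as pointwise convergence of transforms only; bounded holomorphic functions allow the
derivatives to follow. The Leibniz rule is applied to the limit.\<close>

lemma higher_deriv_content_transform_tendsto:
  assumes i: "i \<in> {1..N}" and r: "0 < r"
  shows "(\<lambda>n. (deriv ^^ l) (content_transform n i) (of_real r)) \<longlonglongrightarrow>
    (\<Sum>k=0..l. of_nat (l choose k) * (deriv ^^ k) (\<lambda>u. Z i (of_real a * u)) (of_real r)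
        * (deriv ^^ (l - k)) (laplace_stieltjes (F i)) (of_real r))"
proof -
  have "(\<lambda>n. (deriv ^^ l) (content_transform n i) (of_real r)) \<longlonglongrightarrow>
      (deriv ^^ l) (\<lambda>u. Z i (of_real a * u) * laplace_stieltjes (F i) u) (of_real r)"
  proof (rule higher_deriv_tendsto_of_bounded_pointwise[OF r, where B=1])
    show "content_transform n i holomorphic_on ball (of_real r) r" for n
      unfolding content_transform_def
      by (intro holomorphic_on_mult scaled_transform_holomorphic service_transform_holomorphic i)
    show "(\<lambda>u. Z i (of_real a * u) * laplace_stieltjes (F i) u) holomorphic_on ball (of_real r) r"
      by (intro holomorphic_on_mult scaled_Z_holomorphic service_transform_holomorphic i)
    fix w assume "w \<in> ball (complex_of_real r) r"
    then have w: "0 \<le> Re w" by (rule Re_nonneg_of_ball)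
    show "(\<lambda>n. content_transform n i w) \<longlonglongrightarrow> Z i (of_real a * w) * laplace_stieltjes (F i) w"
      by (rule content_transform_tendsto[OF i w])
    show "norm (content_transform n i w) \<le> 1" for n
      unfolding content_transform_def norm_mult
      using a w by (intro mult_le_one norm_joint_transform_le norm_service_transform_le i) auto
  qed
  also have "(deriv ^^ l) (\<lambda>u. Z i (of_real a * u) * laplace_stieltjes (F i) u) (of_real r)
    = (\<Sum>k=0..l. of_nat (l choose k) * (deriv ^^ k) (\<lambda>u. Z i (of_real a * u)) (of_real r)
        * (deriv ^^ (l - k)) (laplace_stieltjes (F i)) (of_real r))"
    by (rule higher_deriv_mult[OF scaled_Z_holomorphic[OF i, of r] service_transform_holomorphic[OF i]])
      (use r in auto)
  finally show ?thesis .
qed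

text \<open>The prelimit equation relates time \<open>n + 1\<close> to time \<open>n\<close>; both sides converge, so the limit is a fixed
point of it.\<close>

lemma steady_state_transform:
  assumes j: "j \<in> {1..N}" and Re: "0 \<le> Re s" and s: "s \<noteq> of_real (rate j)"
  defines "\<rho> \<equiv> of_real (rate j) / (of_real (rate j) - s)"
  shows "Z j s = (\<Sum>i=1..N. of_real (p i j) * (\<Sum>m=1..M. of_real (q m)
      * (\<rho> ^ m * (Z i (of_real a * s) * laplace_stieltjes (F i) s)
        + (\<Sum>l=0..m-1. (- of_real (rate j)) ^ l / fact l
            * (\<Sum>k=0..l. of_nat (l choose k) * (deriv ^^ k) (\<lambda>u. Z i (of_real a * u)) (of_real (rate j))
                * (deriv ^^ (l - k)) (laplace_stieltjes (F i)) (of_real (rate j))) * (1 - \<rho> ^ (m - l))))))"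
proof (rule LIMSEQ_unique)
  show "(\<lambda>n. joint_transform \<Omega> (W (Suc n)) (Y (Suc n)) j s) \<longlonglongrightarrow> Z j s"
    by (rule LIMSEQ_Suc[OF Z_eq(2)[OF j Re]])
  show "(\<lambda>n. joint_transform \<Omega> (W (Suc n)) (Y (Suc n)) j s) \<longlonglongrightarrow>
      (\<Sum>i=1..N. of_real (p i j) * (\<Sum>m=1..M. of_real (q m)
      * (\<rho> ^ m * (Z i (of_real a * s) * laplace_stieltjes (F i) s)
        + (\<Sum>l=0..m-1. (- of_real (rate j)) ^ l / fact l
            * (\<Sum>k=0..l. of_nat (l choose k) * (deriv ^^ k) (\<lambda>u. Z i (of_real a * u)) (of_real (rate j))
                * (deriv ^^ (l - k)) (laplace_stieltjes (F i)) (of_real (rate j))) * (1 - \<rho> ^ (m - l))))))"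
    unfolding one_step_transform[OF j Re s] \<rho>_def
    by (intro tendsto_sum tendsto_mult tendsto_add tendsto_const content_transform_tendsto
        higher_deriv_content_transform_tendsto rate[OF j] Re)
qed

end

section \<open>Matrix form\<close>

text \<open>Vector positions start at 0 while states start at 1.\<close>

lemma sum_from_1: "(\<Sum>k = 0..<N. f (Suc k)) = (\<Sum>i=1..N. f i)"
  for f :: "nat \<Rightarrow> 'a::comm_monoid_add"
  by (simp add: sum.atLeast1_atMost_eq lessThan_atLeast0)

lemma H_hat_mult_state_vec:
  assumes "k < N"
  shows "(H_hat N p M q rate \<beta> s *\<^sub>v state_vec N z) $ k
    = (\<Sum>i=1..N. (\<Sum>m=1..M. of_real (q m) * erlang_ratio rate (Suc k) s ^ m) * of_real (p i (Suc k)) * \<beta> i s * z i)"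
proof -
  let ?P = "transpose_mat (map_mat complex_of_real (transition_mat N p))"
  let ?L = "\<lambda>j. \<Sum>m=1..M. of_real (q m) * erlang_ratio rate j s ^ m"
  have P: "?P \<in> carrier_mat N N" by (simp add: transition_mat_def)
  have "H_hat N p M q rate \<beta> s = Matrix.mat N N (\<lambda>(k, l). ?L (Suc k) * of_real (p (Suc l) (Suc k)) * \<beta> (Suc l) s)"
    unfolding H_hat_def L_hat_def state_diagonal_def mat_diag_mult_left[OF P]
    by (subst mat_diag_mult_right[of _ N N]) (auto simp: transition_mat_def intro!: eq_matI)
  then have "(H_hat N p M q rate \<beta> s *\<^sub>v state_vec N z) $ k
      = (\<Sum>l = 0..<N. ?L (Suc k) * of_real (p (Suc l) (Suc k)) * \<beta> (Suc l) s * z (Suc l))"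
    using assms by (auto simp: scalar_prod_def state_vec_def intro!: sum.cong)
  then show ?thesis
    using sum_from_1[of "\<lambda>l. ?L (Suc k) * of_real (p l (Suc k)) * \<beta> l s * z l" N] by simp
qed

lemma V_hat_index:
  assumes "k < N"
  shows "V_hat N a p M q rate Z \<beta> s $ k
    = (\<Sum>m=1..M. of_real (q m) * (\<Sum>l=0..m-1. (1 - erlang_ratio rate (Suc k) s ^ (m - l)) * v_coeff N a p rate Z \<beta> (Suc k) l))"
proof -
  have "scalar_prod (Matrix.vec m (\<lambda>_. 1)) (A_mat rate j m s *\<^sub>v Matrix.vec m v)
      = (\<Sum>l=0..m-1. (1 - erlang_ratio rate j s ^ (m - l)) * v l)" if "1 \<le> m" for m j v
  proof -
    have "(A_mat rate j m s *\<^sub>v Matrix.vec m v) $ t = (1 - erlang_ratio rate j s ^ (m - t)) * v t" if "t < m" for t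
    proof -
      let ?d = "\<lambda>l. 1 - erlang_ratio rate j s ^ (m - l)"
      have "(A_mat rate j m s *\<^sub>v Matrix.vec m v) $ t = (\<Sum>l = 0..<m. (if t = l then ?d l else 0) * v l)"
        using that by (simp add: A_mat_def mat_diag_def scalar_prod_def)
      also have "\<dots> = (\<Sum>l = 0..<m. if t = l then ?d l * v l else 0)"
        by (intro sum.cong) auto
      finally show ?thesis using that by simp
    qed
    then have "scalar_prod (Matrix.vec m (\<lambda>_. 1)) (A_mat rate j m s *\<^sub>v Matrix.vec m v)
        = (\<Sum>l = 0..<m. (1 - erlang_ratio rate j s ^ (m - l)) * v l)"
      by (simp add: scalar_prod_def A_mat_def mat_diag_def)
    also have "{0..<m} = {0..m-1}" using that by auto
    finally show ?thesis .
  qed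
  then show ?thesis
    using assms unfolding V_hat_def state_vec_def by (auto intro!: sum.cong)
qed

context modulated_workload begin

lemma steady_state_transform_expanded:
  assumes j: "j \<in> {1..N}" and Re: "0 \<le> Re s" and s: "s \<noteq> of_real (rate j)"
  shows "Z j s =
      (\<Sum>i=1..N. of_real (p i j) *
         (\<Sum>m=1..M. of_real (q m) * (of_real (rate j) / (of_real (rate j) - s)) ^ m
            * Z i (of_real a * s) * laplace_stieltjes (F i) s))
    + (\<Sum>i=1..N. of_real (p i j) *
         (\<Sum>m=1..M. of_real (q m) *
           (\<Sum>l=0..m-1. \<Sum>k=0..l.
              (- of_real (rate j)) ^ l / fact l * of_nat (l choose k)
              * (deriv ^^ k) (\<lambda>u. Z i (of_real a * u)) (of_real (rate j))
              * (deriv ^^ (l - k)) (laplace_stieltjes (F i)) (of_real (rate j))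
              * (1 - (of_real (rate j) / (of_real (rate j) - s)) ^ (m - l)))))"
  unfolding steady_state_transform[OF j Re s]
  by (simp only: distrib_left sum.distrib sum_distrib_left sum_distrib_right mult.assoc)

end

lemma transform_equation_matrix_form:
  assumes eq: "\<And>j. j \<in> {1..N} \<Longrightarrow> Z j s =
      (\<Sum>i=1..N. of_real (p i j) *
         (\<Sum>m=1..M. of_real (q m) * (of_real (rate j) / (of_real (rate j) - s)) ^ m
            * Z i (of_real a * s) * \<beta> i s))
    + (\<Sum>i=1..N. of_real (p i j) *
         (\<Sum>m=1..M. of_real (q m) *
           (\<Sum>l=0..m-1. \<Sum>k=0..l.
              (- of_real (rate j)) ^ l / fact l * of_nat (l choose k)
              * (deriv ^^ k) (\<lambda>u. Z i (of_real a * u)) (of_real (rate j))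
              * (deriv ^^ (l - k)) (\<beta> i) (of_real (rate j))
              * (1 - (of_real (rate j) / (of_real (rate j) - s)) ^ (m - l)))))"
  shows "state_vec N (\<lambda>j. Z j s) =
    H_hat N p M q rate \<beta> s *\<^sub>v state_vec N (\<lambda>j. Z j (of_real a * s))
    + V_hat N a p M q rate Z \<beta> s"
proof (rule eq_vecI)
  show "dim_vec (state_vec N (\<lambda>j. Z j s)) = dim_vec (H_hat N p M q rate \<beta> s *\<^sub>v state_vec N (\<lambda>j. Z j (of_real a * s))
    + V_hat N a p M q rate Z \<beta> s)"
    by (simp add: state_vec_def V_hat_def)
  fix t assume "t < dim_vec (H_hat N p M q rate \<beta> s *\<^sub>v state_vec N (\<lambda>j. Z j (of_real a * s)) + V_hat N a p M q rate Z \<beta> s)"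
  then have t: "t < N" by (simp add: V_hat_def state_vec_def)
  define j where "j = Suc t"
  have j: "j \<in> {1..N}" using t by (simp add: j_def)
  let ?\<rho> = "erlang_ratio rate j s"
  let ?G = "\<lambda>i m l k. of_real (p i j) * (of_real (q m) *
      ((- of_real (rate j)) ^ l / fact l * of_nat (l choose k) * scaled_deriv Z a k i (rate j)
        * (deriv ^^ (l - k)) (\<beta> i) (of_real (rate j)) * (1 - ?\<rho> ^ (m - l))))"
  have H: "(H_hat N p M q rate \<beta> s *\<^sub>v state_vec N (\<lambda>j. Z j (of_real a * s))) $ t
      = (\<Sum>i=1..N. of_real (p i j) * (\<Sum>m=1..M. of_real (q m) * ?\<rho> ^ m * Z i (of_real a * s) * \<beta> i s))"
    unfolding H_hat_mult_state_vec[OF t] j_def[symmetric] sum_distrib_left sum_distrib_right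
    by (intro sum.cong refl) (simp only: mult_ac)
  have "(\<Sum>i=1..N. of_real (p i j) * (\<Sum>m=1..M. of_real (q m) *
        (\<Sum>l=0..m-1. \<Sum>k=0..l. (- of_real (rate j)) ^ l / fact l * of_nat (l choose k) * scaled_deriv Z a k i (rate j)
          * (deriv ^^ (l - k)) (\<beta> i) (of_real (rate j)) * (1 - ?\<rho> ^ (m - l)))))
      = (\<Sum>i=1..N. \<Sum>m=1..M. \<Sum>l=0..m-1. \<Sum>k=0..l. ?G i m l k)"
    by (simp only: sum_distrib_left)
  also have "\<dots> = (\<Sum>m=1..M. \<Sum>i=1..N. \<Sum>l=0..m-1. \<Sum>k=0..l. ?G i m l k)"
    by (rule sum.swap)
  also have "\<dots> = (\<Sum>m=1..M. \<Sum>l=0..m-1. \<Sum>i=1..N. \<Sum>k=0..l. ?G i m l k)"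
    by (intro sum.cong refl sum.swap)
  also have "\<dots> = (\<Sum>m=1..M. \<Sum>l=0..m-1. \<Sum>k=0..l. \<Sum>i=1..N. ?G i m l k)"
    by (intro sum.cong refl sum.swap)
  also have "\<dots> = V_hat N a p M q rate Z \<beta> s $ t"
    unfolding V_hat_index[OF t] j_def[symmetric] v_coeff_def sum_distrib_left sum_distrib_right
    by (intro sum.cong refl) (simp only: mult_ac)
  finally have V: "(\<Sum>i=1..N. of_real (p i j) * (\<Sum>m=1..M. of_real (q m) *
        (\<Sum>l=0..m-1. \<Sum>k=0..l. (- of_real (rate j)) ^ l / fact l * of_nat (l choose k) * scaled_deriv Z a k i (rate j)
          * (deriv ^^ (l - k)) (\<beta> i) (of_real (rate j)) * (1 - ?\<rho> ^ (m - l)))))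
      = V_hat N a p M q rate Z \<beta> s $ t" .
  have "state_vec N (\<lambda>j. Z j s) $ t = Z j s"
    using t by (simp add: state_vec_def j_def)
  also have "\<dots> = (H_hat N p M q rate \<beta> s *\<^sub>v state_vec N (\<lambda>j. Z j (of_real a * s))) $ t + V_hat N a p M q rate Z \<beta> s $ t"
    unfolding eq[OF j] H V[symmetric] unfolding erlang_ratio_def scaled_deriv_def ..
  finally show "state_vec N (\<lambda>j. Z j s) $ t = (H_hat N p M q rate \<beta> s *\<^sub>v state_vec N (\<lambda>j. Z j (of_real a * s))
    + V_hat N a p M q rate Z \<beta> s) $ t"
    using t by (simp add: V_hat_def state_vec_def)
qed

theorem theorem7:
  fixes \<Omega> :: "'w measure" and \<Omega>' :: "'v measure"
    and N M :: nat and a :: real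
    and p :: "nat \<Rightarrow> nat \<Rightarrow> real" and \<pi> q rate :: "nat \<Rightarrow> real"
    and Y :: "nat \<Rightarrow> 'w \<Rightarrow> nat" and W S A :: "nat \<Rightarrow> 'w \<Rightarrow> real"
    and F :: "nat \<Rightarrow> real \<Rightarrow> real"
    and Winf :: "'v \<Rightarrow> real" and Yinf :: "'v \<Rightarrow> nat"
  assumes "modulated_workload \<Omega> \<Omega>' N a p \<pi> Y W S A F M q rate Winf Yinf"
  shows "let Z = limit_transform \<Omega> W Y; \<beta> = (\<lambda>i. laplace_stieltjes (F i)) in
    (\<forall>s::complex. 0 \<le> Re s \<and> s \<notin> (\<lambda>j. complex_of_real (rate j)) ` {1..N} \<longrightarrow>
      (\<forall>j\<in>{1..N}.
        Z j s =
          (\<Sum>i=1..N. of_real (p i j) *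
             (\<Sum>m=1..M. of_real (q m) * (of_real (rate j) / (of_real (rate j) - s)) ^ m
                * Z i (of_real a * s) * \<beta> i s))
        + (\<Sum>i=1..N. of_real (p i j) *
             (\<Sum>m=1..M. of_real (q m) *
               (\<Sum>l=0..m-1. \<Sum>k=0..l.
                  (- of_real (rate j)) ^ l / fact l * of_nat (l choose k)
                  * (deriv ^^ k) (\<lambda>u. Z i (of_real a * u)) (of_real (rate j))
                  * (deriv ^^ (l - k)) (\<beta> i) (of_real (rate j))
                  * (1 - (of_real (rate j) / (of_real (rate j) - s)) ^ (m - l)))))) \<and>
      state_vec N (\<lambda>j. Z j s) =
        H_hat N p M q rate \<beta> s *\<^sub>v state_vec N (\<lambda>j. Z j (of_real a * s))
        + V_hat N a p M q rate Z \<beta> s)"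
proof -
  interpret modulated_workload \<Omega> \<Omega>' N a p \<pi> Y W S A F M q rate Winf Yinf by fact
  have ne: "s \<noteq> of_real (rate j)"
    if "s \<notin> (\<lambda>j. complex_of_real (rate j)) ` {1..N}" "j \<in> {1..N}" for s j
    using that by auto
  note scalar = steady_state_transform_expanded[OF _ _ ne]
  show ?thesis
    unfolding Let_def
    by (intro allI impI conjI ballI, rule scalar, assumption, erule conjunct1, erule conjunct2, assumption,
        rule transform_equation_matrix_form, rule scalar, assumption, erule conjunct1, erule conjunct2, assumption)
qed

end
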